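(* Let $\Omega\subset\mathbb R^N$ be open, and let $F,a\in C^\infty(\Omega)$ with $a>0$. Assume $\nabla F\ne0$ on $\{F=0\}\cap\Omega$ and that this hypersurface, denoted $C_{\rm reg}\cap\Omega$, is minimal. Let $\mathcal K_F(a)$ be the smooth extension to $\Omega$ of $\mathcal L(aF)/F$. Then along $C_{\rm reg}\cap\Omega$, $$\mathcal K_F(a)\big|_{C_{\rm reg}}=-a^4|\nabla F|^3\,J_{C_{\rm reg}}\!\left(\frac1{a|\nabla F|}\right).$$ Consequently, if $\mathcal K_F(a)\ge0$ near this hypersurface, then $w=(a|\nabla F|)^{-1}>0$ satisfies $J_Cw\le0$ on it; and $w$ is a Jacobi field ($J_Cw=0$) exactly when $\mathcal K_F(a)$ vanishes on the hypersurface.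
   Context: For a smooth function $G$, $\mathcal L(G)=|\nabla G|^2\Delta G-\frac12\langle\nabla|\nabla G|^2,\nabla G\rangle$. Under the stated hypotheses $\mathcal L(aF)$ vanishes on $\{F=0\}\cap\Omega$, so the quotient $\mathcal L(aF)/F$ extends to a smooth function on $\Omega$. On $C_{\rm reg}=\{F=0,\nabla F\ne0\}$, $J_{C_{\rm reg}}=J_C=\Delta_{C_{\rm reg}}+|A_C|^2$, where $\Delta_{C_{\rm reg}}$ is the Laplace--Beltrami operator (convention $\int u\Delta u=-\int|\nabla u|^2$) and $A_C$ the second fundamental form. *)

theory Defs
  imports "HOL-Analysis.Analysis"
begin

section \<open>Calculus on open subsets of Euclidean space\<close>

primrec Ck_on :: "nat \<Rightarrow> 'a::euclidean_space set \<Rightarrow> ('a \<Rightarrow> real) \<Rightarrow> bool" where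
  "Ck_on 0 S f \<longleftrightarrow> continuous_on S f"
| "Ck_on (Suc k) S f \<longleftrightarrow>
     (\<forall>x\<in>S. f differentiable (at x)) \<and>
     (\<forall>v. Ck_on k S (\<lambda>x. frechet_derivative f (at x) v))"

definition smooth_on :: "'a::euclidean_space set \<Rightarrow> ('a \<Rightarrow> real) \<Rightarrow> bool" where
  "smooth_on S f \<longleftrightarrow> (\<forall>k. Ck_on k S f)"

definition grad :: "('a::euclidean_space \<Rightarrow> real) \<Rightarrow> 'a \<Rightarrow> 'a" where
  "grad f x = (THE D. GDERIV f x :> D)"

definition laplacian :: "('a::euclidean_space \<Rightarrow> real) \<Rightarrow> 'a \<Rightarrow> real" where
  "laplacian f x = (\<Sum>b\<in>Basis. frechet_derivative (\<lambda>y. grad f y \<bullet> b) (at x) b)"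

definition L_op :: "('a::euclidean_space \<Rightarrow> real) \<Rightarrow> 'a \<Rightarrow> real" where
  "L_op G x = (norm (grad G x))\<^sup>2 * laplacian G x
     - 1 / 2 * (grad (\<lambda>y. (norm (grad G y))\<^sup>2) x \<bullet> grad G x)"

text \<open>\<open>K\<close> is a smooth extension to \<open>\<Omega>\<close> of the quotient \<open>f / F\<close>, which is a priori
  defined only where \<open>F\<close> does not vanish.\<close>

definition smooth_quotient_extension ::
    "'a::euclidean_space set \<Rightarrow> ('a \<Rightarrow> real) \<Rightarrow> ('a \<Rightarrow> real) \<Rightarrow> ('a \<Rightarrow> real) \<Rightarrow> bool" where
  "smooth_quotient_extension \<Omega> f F K \<longleftrightarrow>
     smooth_on \<Omega> K \<and> (\<forall>x\<in>\<Omega>. F x \<noteq> 0 \<longrightarrow> K x = f x / F x)"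

definition regular_zero_set :: "'a::euclidean_space set \<Rightarrow> ('a \<Rightarrow> real) \<Rightarrow> 'a set" where
  "regular_zero_set \<Omega> F = {x\<in>\<Omega>. F x = 0 \<and> grad F x \<noteq> 0}"


section \<open>Extrinsic geometry of embedded submanifolds\<close>

text \<open>The definitions below are meant for embedded submanifolds \<open>M\<close> of Euclidean space with
  the induced metric. For functions on \<open>M\<close>, the derivative \<open>at p within M\<close> depends only on
  the values on \<open>M\<close>; as a linear map it is determined only on tangent vectors at \<open>p\<close>, and it
  is evaluated only there.\<close>

definition tangent_space :: "'a::euclidean_space set \<Rightarrow> 'a \<Rightarrow> 'a set" where
  "tangent_space M p = {v. \<exists>\<gamma>::real \<Rightarrow> 'a. \<gamma> 0 = p \<and> (\<forall>\<^sub>F t in nhds 0. \<gamma> t \<in> M) \<and>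
     (\<gamma> has_vector_derivative v) (at 0)}"

definition onb :: "'a::euclidean_space set \<Rightarrow> 'a set" where
  "onb T = (SOME B. pairwise orthogonal B \<and> (\<forall>b\<in>B. norm b = 1) \<and> span B = T)"

definition orth_proj :: "'a::euclidean_space set \<Rightarrow> 'a \<Rightarrow> 'a" where
  "orth_proj T w = (\<Sum>e\<in>onb T. (w \<bullet> e) *\<^sub>R e)"

definition tangential_grad ::
    "'a::euclidean_space set \<Rightarrow> ('a \<Rightarrow> real) \<Rightarrow> 'a \<Rightarrow> 'a" where
  "tangential_grad M u p = (THE \<xi>. \<xi> \<in> tangent_space M p \<and>
     (\<forall>v\<in>tangent_space M p. \<xi> \<bullet> v = frechet_derivative u (at p within M) v))"

text \<open>For a tangent field this is the Riemannian divergence, because the Levi-Civita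
  connection of the induced metric is the tangential part of the Euclidean derivative.\<close>

definition tangential_div ::
    "'a::euclidean_space set \<Rightarrow> ('a \<Rightarrow> 'a) \<Rightarrow> 'a \<Rightarrow> real" where
  "tangential_div M X p =
     (\<Sum>e\<in>onb (tangent_space M p). frechet_derivative X (at p within M) e \<bullet> e)"

definition laplace_beltrami ::
    "'a::euclidean_space set \<Rightarrow> ('a \<Rightarrow> real) \<Rightarrow> 'a \<Rightarrow> real" where
  "laplace_beltrami M u p = tangential_div M (tangential_grad M u) p"

text \<open>The vector-valued second fundamental form \<open>A(v, w) = (D\<^sub>v W)\<^sup>\<bottom>\<close> for \<open>v, w\<close> tangent at \<open>p\<close>.
  It does not depend on the tangent field \<open>W\<close> extending \<open>w\<close>; here \<open>W q\<close> is the orthogonal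
  projection of \<open>w\<close> onto the tangent space at \<open>q\<close>. For a hypersurface with local unit normal
  field \<open>\<nu>\<close> this is \<open>- (D\<^sub>v \<nu> \<bullet> w) \<nu>\<close>.\<close>

definition second_fundamental_form ::
    "'a::euclidean_space set \<Rightarrow> 'a \<Rightarrow> 'a \<Rightarrow> 'a \<Rightarrow> 'a" where
  "second_fundamental_form M p v w =
     (let D = frechet_derivative (\<lambda>q. orth_proj (tangent_space M q) w) (at p within M) v
      in D - orth_proj (tangent_space M p) D)"

definition mean_curvature_vector :: "'a::euclidean_space set \<Rightarrow> 'a \<Rightarrow> 'a" where
  "mean_curvature_vector M p =
     (\<Sum>e\<in>onb (tangent_space M p). second_fundamental_form M p e e)"

definition minimal_submanifold :: "'a::euclidean_space set \<Rightarrow> bool" where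
  "minimal_submanifold M \<longleftrightarrow> (\<forall>p\<in>M. mean_curvature_vector M p = 0)"

definition norm_sq_second_fundamental_form :: "'a::euclidean_space set \<Rightarrow> 'a \<Rightarrow> real" where
  "norm_sq_second_fundamental_form M p =
     (\<Sum>e\<in>onb (tangent_space M p). \<Sum>e'\<in>onb (tangent_space M p).
        (norm (second_fundamental_form M p e e'))\<^sup>2)"

definition jacobi_operator ::
    "'a::euclidean_space set \<Rightarrow> ('a \<Rightarrow> real) \<Rightarrow> 'a \<Rightarrow> real" where
  "jacobi_operator M u p =
     laplace_beltrami M u p + norm_sq_second_fundamental_form M p * u p"

end

theory Submission
  imports Defs
begin

text \<open>
  Put \<open>G = a F\<close>. Then \<open>G\<close> has the same regular zero set \<open>C\<close> as \<open>F\<close>, and \<open>\<nabla>G = a \<nabla>F\<close> along \<open>C\<close>, so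
  \<open>w = 1 / \<bar>\<nabla>G\<bar>\<close> there. The Jacobi operator only sees the restriction of its argument to \<open>C\<close>; hence
  the weight \<open>a\<close> disappears and the geometry concerns a single function \<open>G\<close> with \<open>1 / \<bar>\<nabla>G\<bar>\<close>.

  \<^emph>\<open>The identity.\<close> With \<open>n = \<nabla>G(p)\<close>, \<open>H = D\<^sup>2G(p)\<close> and \<open>T = D\<^sup>3G(p)\<close>, one has
  \<open>L(G) = \<bar>n\<bar>\<^sup>2 tr H - (Hn \<bullet> n)\<close>, which is \<open>\<bar>n\<bar>\<^sup>2\<close> times the trace of \<open>H\<close> over the hyperplane \<open>n\<^sup>\<bottom>\<close>,
  the tangent space of \<open>C\<close>. Since the second fundamental form is \<open>- (H \<bullet> \<cdot>) n / \<bar>n\<bar>\<^sup>2\<close>, minimality says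
  exactly that this trace vanishes, so \<open>L(G) = 0\<close> on \<open>C\<close>. Expanding both the derivative of \<open>L(G)\<close>
  along \<open>n\<close> and the Jacobi operator of \<open>1 / \<bar>\<nabla>G\<bar>\<close> in an orthonormal basis \<open>E\<close> of the tangent space
  leaves in both cases only \<open>S1 = \<Sum>e\<in>E. (Hn \<bullet> e)\<^sup>2\<close> and \<open>S2 = \<Sum>e\<in>E. T n e \<bullet> e\<close>; the term
  \<open>\<bar>A\<bar>\<^sup>2 / \<bar>n\<bar>\<close> of the Jacobi operator cancels the tangential part of \<open>\<Sum>e\<in>E. He \<bullet> He\<close>,
  which the Laplacian contributes.
  The result is lemma \<open>normal_derivative_L_op\<close>. If \<open>K\<close> extends \<open>L(G) / F\<close>, then \<open>L(G) = F K\<close> on \<open>\<Omega>\<close>, and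
  differentiating this product along \<open>n\<close> at a zero of \<open>F\<close> isolates \<open>K\<close>.

  \<^emph>\<open>The extension.\<close> A smooth \<open>f\<close> that vanishes on the regular zero set of \<open>F\<close> is divisible by \<open>F\<close>
  in the smooth functions (lemma \<open>smooth_division\<close>). The
  vector field \<open>X = \<nabla>F / \<bar>\<nabla>F\<bar>\<^sup>2\<close> satisfies \<open>X F = 1\<close>, so it plays the role of the partial derivative
  in the direction of the coordinate \<open>F\<close>, and a Taylor expansion along it gives, for every \<open>m\<close>, a
  smooth \<open>h\<close> such that \<open>f - F h\<close> vanishes to order \<open>m\<close> on the zero set. The quotient of a function
  that vanishes to high order by a fixed power of \<open>F\<close> is \<open>C\<^sup>k\<close>, with \<open>k\<close> as large as desired.
\<close>

section \<open>Smooth functions and their partial derivatives\<close>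

abbreviation dirderiv :: "'a::euclidean_space \<Rightarrow> ('a \<Rightarrow> real) \<Rightarrow> 'a \<Rightarrow> real" where
  "dirderiv v f \<equiv> (\<lambda>x. frechet_derivative f (at x) v)"

lemma frechet_derivative_eqI:
  "(f has_derivative f') (at x) \<Longrightarrow> frechet_derivative f (at x) v = f' v"
  using frechet_derivative_at by metis

lemma frechet_derivative_cong_open:
  assumes "open S" "x \<in> S" "\<And>y. y \<in> S \<Longrightarrow> f y = g y"
  shows "frechet_derivative f (at x) = frechet_derivative g (at x)"
proof -
  have "(f has_derivative f') (at x) \<longleftrightarrow> (g has_derivative f') (at x)" for f'
    using has_derivative_transform_within_open[OF _ assms(1,2)] assms(3) by metis
  then show ?thesis unfolding frechet_derivative_def by simp
qed

lemma Ck_on_cong: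
  assumes "open S" "\<And>x. x \<in> S \<Longrightarrow> f x = g x" "Ck_on k S f"
  shows "Ck_on k S g"
  using assms(2,3)
proof (induction k arbitrary: f g)
  case 0
  then show ?case using continuous_on_cong[of S S f g] by simp
next
  case (Suc k)
  have fd: "frechet_derivative f (at x) = frechet_derivative g (at x)" if "x \<in> S" for x
    using frechet_derivative_cong_open[OF assms(1) that] Suc.prems(1) by blast
  have "g differentiable (at x)" if "x \<in> S" for x
  proof -
    have "f differentiable (at x)" using Suc.prems(2) that by simp
    then show ?thesis
      using has_derivative_transform_within_open[OF _ assms(1) that] Suc.prems(1)
      unfolding differentiable_def by metis
  qed
  moreover have "Ck_on k S (dirderiv v g)" for v
    by (rule Suc.IH[of "dirderiv v f"]) (use Suc.prems fd in auto)
  ultimately show ?case by simp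
qed

lemma Ck_on_SucD: "Ck_on (Suc k) S f \<Longrightarrow> Ck_on k S f"
proof (induction k arbitrary: f)
  case 0
  then show ?case
    using differentiable_imp_continuous_on[of f S] differentiable_at_withinI
    unfolding differentiable_on_def by auto
qed auto

lemma Ck_on_Suc_has_derivative:
  "Ck_on (Suc k) S f \<Longrightarrow> x \<in> S \<Longrightarrow> (f has_derivative frechet_derivative f (at x)) (at x)"
  using frechet_derivative_works by auto

text \<open>The closure properties below are inductions on \<open>k\<close> in which the derivative is given by an explicit
  formula; this rule is the induction step for such a formula.\<close>

lemma Ck_on_SucI:
  assumes "open S" "\<And>x. x \<in> S \<Longrightarrow> (f has_derivative f' x) (at x)"
    "\<And>v. Ck_on k S (\<lambda>x. f' x v)"
  shows "Ck_on (Suc k) S f"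
  using assms(2,3)
  by (auto simp: differentiable_def intro: Ck_on_cong[OF assms(1) _ assms(3)]
      frechet_derivative_eqI[symmetric])

lemma Ck_on_const: "open S \<Longrightarrow> Ck_on k S (\<lambda>x. c)"
proof (induction k arbitrary: c)
  case (Suc k)
  show ?case by (rule Ck_on_SucI[OF Suc.prems has_derivative_const]) (rule Suc)+
qed simp

lemma Ck_on_add:
  assumes "open S"
  shows "Ck_on k S f \<Longrightarrow> Ck_on k S g \<Longrightarrow> Ck_on k S (\<lambda>x. f x + g x)"
proof (induction k arbitrary: f g)
  case (Suc k)
  note d = Suc.prems[THEN Ck_on_Suc_has_derivative]
  show ?case
    by (rule Ck_on_SucI[OF assms has_derivative_add[OF d]]) (use Suc in simp_all)
qed (simp add: continuous_on_add)

lemma Ck_on_mult: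
  assumes "open S"
  shows "Ck_on k S f \<Longrightarrow> Ck_on k S g \<Longrightarrow> Ck_on k S (\<lambda>x. f x * g x)"
proof (induction k arbitrary: f g)
  case (Suc k)
  note d = Suc.prems[THEN Ck_on_Suc_has_derivative]
  note lower = Suc.prems[THEN Ck_on_SucD]
  have "Ck_on k S (\<lambda>x. f x * frechet_derivative g (at x) v + frechet_derivative f (at x) v * g x)" for v
    by (intro Ck_on_add[OF assms] Suc.IH lower) (use Suc.prems in simp_all)
  then show ?case
    by (intro Ck_on_SucI[OF assms has_derivative_mult[OF d]])
qed (simp add: continuous_on_mult)

lemma Ck_on_inverse:
  assumes "open S" "\<And>x. x \<in> S \<Longrightarrow> f x \<noteq> 0"
  shows "Ck_on k S f \<Longrightarrow> Ck_on k S (\<lambda>x. inverse (f x))"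
proof (induction k)
  case (Suc k)
  have "Ck_on k S (\<lambda>x. inverse (f x))" using Suc Ck_on_SucD by blast
  moreover have deriv: "((\<lambda>x. inverse (f x)) has_derivative
      (\<lambda>v. (-1) * (inverse (f x) * frechet_derivative f (at x) v * inverse (f x)))) (at x)"
    if "x \<in> S" for x
    using Deriv.has_derivative_inverse[OF assms(2)[OF that] Ck_on_Suc_has_derivative[OF Suc.prems that]]
    by simp
  moreover have "Ck_on k S (dirderiv v f)" for v using Suc.prems by simp
  ultimately have "Ck_on k S (\<lambda>x. (-1) * (inverse (f x) * dirderiv v f x * inverse (f x)))" for v
    by (intro Ck_on_mult[OF assms(1)] Ck_on_const[OF assms(1)])
  with deriv show ?case by (rule Ck_on_SucI[OF assms(1)])
qed (use assms in \<open>auto intro: continuous_on_inverse\<close>)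

lemma Ck_on_Un:
  assumes "open S" "open T"
  shows "Ck_on k S f \<Longrightarrow> Ck_on k T f \<Longrightarrow> Ck_on k (S \<union> T) f"
  by (induction k arbitrary: f) (use assms in \<open>auto intro: continuous_on_open_Un\<close>)

lemma Ck_on_subset: "Ck_on k S f \<Longrightarrow> T \<subseteq> S \<Longrightarrow> Ck_on k T f"
  by (induction k arbitrary: f) (auto intro: continuous_on_subset)

lemma smooth_on_const: "open S \<Longrightarrow> smooth_on S (\<lambda>x. c)"
  unfolding smooth_on_def by (simp add: Ck_on_const)

lemma smooth_on_add:
  "open S \<Longrightarrow> smooth_on S f \<Longrightarrow> smooth_on S g \<Longrightarrow> smooth_on S (\<lambda>x. f x + g x)"
  unfolding smooth_on_def by (simp add: Ck_on_add)

lemma smooth_on_mult: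
  "open S \<Longrightarrow> smooth_on S f \<Longrightarrow> smooth_on S g \<Longrightarrow> smooth_on S (\<lambda>x. f x * g x)"
  unfolding smooth_on_def by (simp add: Ck_on_mult)

lemma smooth_on_inverse:
  "open S \<Longrightarrow> smooth_on S f \<Longrightarrow> (\<And>x. x \<in> S \<Longrightarrow> f x \<noteq> 0) \<Longrightarrow> smooth_on S (\<lambda>x. inverse (f x))"
  unfolding smooth_on_def by (simp add: Ck_on_inverse)

lemma smooth_on_cong:
  "open S \<Longrightarrow> smooth_on S f \<Longrightarrow> (\<And>x. x \<in> S \<Longrightarrow> f x = g x) \<Longrightarrow> smooth_on S g"
  unfolding smooth_on_def using Ck_on_cong by blast

lemma smooth_on_subset: "smooth_on S f \<Longrightarrow> T \<subseteq> S \<Longrightarrow> smooth_on T f"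
  unfolding smooth_on_def using Ck_on_subset by blast

lemma smooth_on_dirderiv: "smooth_on S f \<Longrightarrow> smooth_on S (dirderiv v f)"
  unfolding smooth_on_def by (metis Ck_on.simps(2))

lemma smooth_on_has_derivative:
  "smooth_on S f \<Longrightarrow> x \<in> S \<Longrightarrow> (f has_derivative frechet_derivative f (at x)) (at x)"
  unfolding smooth_on_def using Ck_on_Suc_has_derivative by blast

lemma smooth_on_imp_continuous_on: "smooth_on S f \<Longrightarrow> continuous_on S f"
  unfolding smooth_on_def by (metis Ck_on.simps(1))

lemma smooth_on_cmult: "open S \<Longrightarrow> smooth_on S f \<Longrightarrow> smooth_on S (\<lambda>x. c * f x)"
  by (rule smooth_on_mult[OF _ smooth_on_const])

lemma smooth_on_diff:
  assumes "open S" "smooth_on S f" "smooth_on S g"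
  shows "smooth_on S (\<lambda>x. f x - g x)"
  using smooth_on_add[OF assms(1,2) smooth_on_cmult[OF assms(1,3), of "-1"]] by simp

lemma smooth_on_sum:
  assumes "open S" "\<And>i. i \<in> I \<Longrightarrow> smooth_on S (f i)"
  shows "smooth_on S (\<lambda>x. \<Sum>i\<in>I. f i x)"
  using assms(2)
  by (induction I rule: infinite_finite_induct)
     (auto intro: smooth_on_const smooth_on_add assms(1))

lemma mean_value_along_line:
  fixes f :: "'a::euclidean_space \<Rightarrow> real"
  assumes "0 < h" "\<And>t. 0 \<le> t \<Longrightarrow> t \<le> h \<Longrightarrow> (f has_derivative f' (x + t *\<^sub>R v)) (at (x + t *\<^sub>R v))"
  shows "\<exists>t. 0 < t \<and> t < h \<and> f (x + h *\<^sub>R v) - f x = h * f' (x + t *\<^sub>R v) v"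
proof -
  have "((\<lambda>t. f (x + t *\<^sub>R v)) has_real_derivative f' (x + t *\<^sub>R v) v) (at t)"
    if "0 \<le> t" "t \<le> h" for t
  proof -
    have "((\<lambda>t. x + t *\<^sub>R v) has_derivative (\<lambda>s. s *\<^sub>R v)) (at t)"
      by (auto intro!: derivative_eq_intros)
    then have "((\<lambda>t. f (x + t *\<^sub>R v)) has_derivative (\<lambda>s. f' (x + t *\<^sub>R v) (s *\<^sub>R v))) (at t)"
      using has_derivative_compose assms(2)[OF that] by blast
    moreover have "f' (x + t *\<^sub>R v) (s *\<^sub>R v) = f' (x + t *\<^sub>R v) v * s" for s
      using linear_scale[OF has_derivative_linear[OF assms(2)[OF that]]] by simp
    ultimately show ?thesis by (simp add: has_field_derivative_def)
  qed
  from MVT2[OF assms(1) this] show ?thesis by auto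
qed

text \<open>Two applications of the mean value theorem to the second difference of \<open>f\<close> over a small
  parallelogram. The second difference is symmetric in \<open>u\<close> and \<open>v\<close>, which forces the two mixed
  derivatives to agree at points arbitrarily close to \<open>x\<close>.\<close>

lemma mixed_partials_close:
  fixes f :: "'a::euclidean_space \<Rightarrow> real"
  assumes "Ck_on 2 (ball x r) f" "0 < h" "h * (norm u + norm v) < r"
  shows "\<exists>y. dist x y \<le> h * (norm u + norm v) \<and>
     f (x + h *\<^sub>R u + h *\<^sub>R v) - f (x + h *\<^sub>R u) - f (x + h *\<^sub>R v) + f x
       = h * (h * dirderiv v (dirderiv u f) y)"
proof -
  have le: "dist x (x + s *\<^sub>R u + t *\<^sub>R v) \<le> h * (norm u + norm v)"
    if "0 \<le> s" "s \<le> h" "0 \<le> t" "t \<le> h" for s t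
  proof -
    have "dist x (x + s *\<^sub>R u + t *\<^sub>R v) = norm (s *\<^sub>R u + t *\<^sub>R v)"
      by (metis add.assoc add_diff_cancel_left' dist_commute dist_norm)
    also have "\<dots> \<le> norm (s *\<^sub>R u) + norm (t *\<^sub>R v)"
      by (rule norm_triangle_ineq)
    also have "\<dots> \<le> h * norm u + h * norm v"
      using that by (auto intro!: add_mono mult_right_mono)
    finally show ?thesis by (simp add: algebra_simps)
  qed
  have inb: "x + s *\<^sub>R u + t *\<^sub>R v \<in> ball x r" if "0 \<le> s" "s \<le> h" "0 \<le> t" "t \<le> h" for s t
    using le[OF that] assms(3) by simp
  have C2: "Ck_on (Suc (Suc 0)) (ball x r) f" using assms(1) by (simp add: numeral_2_eq_2)
  have d1: "(f has_derivative frechet_derivative f (at y)) (at y)" if "y \<in> ball x r" for y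
    using Ck_on_Suc_has_derivative[OF C2 that] .
  have "Ck_on (Suc 0) (ball x r) (dirderiv u f)" using C2 by simp
  note d2 = Ck_on_Suc_has_derivative[OF this]
  define f' where "f' y = (\<lambda>w. frechet_derivative f (at (y + h *\<^sub>R v)) w - frechet_derivative f (at y) w)" for y
  have "((\<lambda>y. f (y + h *\<^sub>R v) - f y) has_derivative f' (x + s *\<^sub>R u)) (at (x + s *\<^sub>R u))"
    if "0 \<le> s" "s \<le> h" for s
  proof -
    have "((\<lambda>y. y + h *\<^sub>R v) has_derivative (\<lambda>w. w)) (at (x + s *\<^sub>R u))"
      by (auto intro!: derivative_eq_intros)
    moreover have "x + s *\<^sub>R u + h *\<^sub>R v \<in> ball x r" using inb[OF that, of h] assms(2) by simp
    ultimately have "((\<lambda>y. f (y + h *\<^sub>R v)) has_derivative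
        frechet_derivative f (at (x + s *\<^sub>R u + h *\<^sub>R v))) (at (x + s *\<^sub>R u))"
      using has_derivative_compose[where g = f, OF _ d1] by blast
    moreover have "(f has_derivative frechet_derivative f (at (x + s *\<^sub>R u))) (at (x + s *\<^sub>R u))"
      using d1[OF inb[OF that, of 0]] assms(2) by simp
    ultimately show ?thesis unfolding f'_def by (rule has_derivative_diff)
  qed
  from mean_value_along_line[OF assms(2) this] obtain s where s: "0 < s" "s < h"
    and eq1: "f (x + h *\<^sub>R u + h *\<^sub>R v) - f (x + h *\<^sub>R u) - (f (x + h *\<^sub>R v) - f x)
      = h * f' (x + s *\<^sub>R u) u" by blast
  have "\<exists>t. 0 < t \<and> t < h \<and> dirderiv u f (x + s *\<^sub>R u + h *\<^sub>R v) - dirderiv u f (x + s *\<^sub>R u)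
      = h * frechet_derivative (dirderiv u f) (at (x + s *\<^sub>R u + t *\<^sub>R v)) v"
    by (rule mean_value_along_line[OF assms(2)]) (rule d2, rule inb, use s in auto)
  then obtain t where "0 < t" "t < h" and eq2: "f' (x + s *\<^sub>R u) u
      = h * dirderiv v (dirderiv u f) (x + s *\<^sub>R u + t *\<^sub>R v)"
    unfolding f'_def by blast
  then show ?thesis using eq1 le[of s t] s
    by (intro exI[of _ "x + s *\<^sub>R u + t *\<^sub>R v"]) auto
qed

lemma mixed_partials_commute:
  fixes f :: "'a::euclidean_space \<Rightarrow> real"
  assumes "open S" "x \<in> S" "Ck_on 2 S f"
  shows "dirderiv v (dirderiv u f) x = dirderiv u (dirderiv v f) x"
proof -
  let ?N = "norm u + norm v"
  obtain r where r: "0 < r" "ball x r \<subseteq> S" using assms(1,2) openE by blast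
  have C: "Ck_on 2 (ball x r) f" using Ck_on_subset assms(3) r(2) by blast
  have "continuous_on (ball x r) (dirderiv a (dirderiv b f))" for a b
    using C by (simp add: numeral_2_eq_2)
  then have ct: "isCont (dirderiv a (dirderiv b f)) x" for a b
    using r(1) by (simp add: continuous_on_eq_continuous_at)
  have N1: "?N + 1 > 0" using norm_ge_zero[of u] norm_ge_zero[of v] by linarith
  have close: "\<bar>dirderiv v (dirderiv u f) x - dirderiv u (dirderiv v f) x\<bar> < 2 * e" if e: "e > 0" for e
  proof -
    have near: "\<exists>d>0. \<forall>y. dist y x < d \<longrightarrow>
        \<bar>dirderiv a (dirderiv b f) y - dirderiv a (dirderiv b f) x\<bar> < e" for a b
      using ct[where a = a and b = b] e unfolding continuous_at_eps_delta dist_real_def by blast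
    obtain d1 where d1: "d1 > 0" "\<And>y. dist y x < d1 \<Longrightarrow>
        \<bar>dirderiv v (dirderiv u f) y - dirderiv v (dirderiv u f) x\<bar> < e"
      using near[where a = v and b = u] by blast
    obtain d2 where d2: "d2 > 0" "\<And>y. dist y x < d2 \<Longrightarrow>
        \<bar>dirderiv u (dirderiv v f) y - dirderiv u (dirderiv v f) x\<bar> < e"
      using near[where a = u and b = v] by blast
    define h where "h = min r (min d1 d2) / (?N + 1)"
    have h: "0 < h" unfolding h_def using r(1) d1(1) d2(1) N1 by simp
    have "h * (?N + 1) = min r (min d1 d2)" unfolding h_def using N1 by simp
    then have hN: "h * ?N < min r (min d1 d2)" using h unfolding distrib_left by linarith
    obtain y where y: "dist x y \<le> h * ?N"
      "f (x + h *\<^sub>R u + h *\<^sub>R v) - f (x + h *\<^sub>R u) - f (x + h *\<^sub>R v) + f x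
         = h * (h * dirderiv v (dirderiv u f) y)"
      using mixed_partials_close[OF C h, of u v] hN by auto
    obtain z where z: "dist x z \<le> h * ?N"
      "f (x + h *\<^sub>R v + h *\<^sub>R u) - f (x + h *\<^sub>R v) - f (x + h *\<^sub>R u) + f x
         = h * (h * dirderiv u (dirderiv v f) z)"
      using mixed_partials_close[OF C h, of v u] hN unfolding add.commute[of "norm v" "norm u"] by auto
    have swap: "x + h *\<^sub>R u + h *\<^sub>R v = x + h *\<^sub>R v + h *\<^sub>R u" by (simp only: ac_simps)
    have "h * (h * dirderiv v (dirderiv u f) y) = h * (h * dirderiv u (dirderiv v f) z)"
      using y(2) z(2) unfolding swap by linarith
    then have "dirderiv v (dirderiv u f) y = dirderiv u (dirderiv v f) z" using h by simp
    moreover have "dist y x < d1" "dist z x < d2"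
      using y(1) z(1) hN by (auto simp: dist_commute)
    ultimately show ?thesis using d1(2)[of y] d2(2)[of z] by linarith
  qed
  have "\<bar>dirderiv v (dirderiv u f) x - dirderiv u (dirderiv v f) x\<bar> \<le> 0"
  proof (rule field_le_epsilon)
    fix e :: real assume "0 < e"
    then show "\<bar>dirderiv v (dirderiv u f) x - dirderiv u (dirderiv v f) x\<bar> \<le> 0 + e"
      using close[of "e/2"] by simp
  qed
  then show ?thesis by simp
qed

section \<open>Tangent spaces of level sets and adapted frames\<close>

lemma has_derivative_grad:
  assumes "f differentiable (at x)"
  shows "(f has_derivative (\<lambda>v. v \<bullet> grad f x)) (at x)"
proof -
  obtain f' where f': "(f has_derivative f') (at x)" using assms unfolding differentiable_def by blast
  obtain A where A: "\<And>v. f' v = v \<bullet> A"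
    using adjoint_works[OF has_derivative_linear[OF f'], of _ 1] by (metis inner_real_def mult.right_neutral)
  have f'_eq: "f' = (\<lambda>v. v \<bullet> A)" using A by (rule ext)
  have "GDERIV f x :> A" using f' unfolding gderiv_def f'_eq .
  moreover have "D = A" if "GDERIV f x :> D" for D
  proof -
    have "(\<lambda>v. v \<bullet> D) = (\<lambda>v. v \<bullet> A)"
      using that f' has_derivative_unique unfolding gderiv_def f'_eq by blast
    then have "\<forall>v. v \<bullet> D = v \<bullet> A" by (rule fun_eq_iff[THEN iffD1])
    then show ?thesis by (simp add: vector_eq_ldot)
  qed
  ultimately have "GDERIV f x :> grad f x" unfolding grad_def by (rule theI)
  then show ?thesis unfolding gderiv_def .
qed

lemma grad_eqI:
  assumes "(f has_derivative (\<lambda>v. v \<bullet> D)) (at x)"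
  shows "grad f x = D"
proof -
  have "f differentiable (at x)" using assms by (rule differentiableI)
  from has_derivative_unique[OF has_derivative_grad[OF this] assms]
  have "\<forall>v. v \<bullet> grad f x = v \<bullet> D" by (rule fun_eq_iff[THEN iffD1])
  then show ?thesis by (simp add: vector_eq_ldot)
qed

lemma dirderiv_eq_inner_grad:
  "f differentiable (at x) \<Longrightarrow> dirderiv v f x = v \<bullet> grad f x"
  by (rule frechet_derivative_eqI[OF has_derivative_grad])

text \<open>A derivative within a lower dimensional set is not unique as a linear map, so
  \<open>frechet_derivative\<close> returns an arbitrary choice. Along tangent vectors all choices agree: composing
  with a curve reduces the matter to the uniqueness of derivatives on the line.\<close>

lemma frechet_derivative_within_tangent:
  fixes f :: "'a::euclidean_space \<Rightarrow> 'b::real_normed_vector"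
  assumes f': "(f has_derivative f') (at p within M)" and v: "v \<in> tangent_space M p"
  shows "frechet_derivative f (at p within M) v = f' v"
proof -
  have g': "(f has_derivative frechet_derivative f (at p within M)) (at p within M)"
    using differentiableI[OF f'] unfolding frechet_derivative_works .
  obtain \<gamma> :: "real \<Rightarrow> 'a" where \<gamma>: "\<gamma> 0 = p" "\<forall>\<^sub>F t in nhds 0. \<gamma> t \<in> M"
    "(\<gamma> has_vector_derivative v) (at 0)"
    using v unfolding tangent_space_def by blast
  obtain S where S: "open S" "(0::real) \<in> S" "\<And>t. t \<in> S \<Longrightarrow> \<gamma> t \<in> M"
    using \<gamma>(2) unfolding eventually_nhds by blast
  have "(f \<circ> \<gamma> has_derivative h \<circ> (\<lambda>t. t *\<^sub>R v)) (at 0)"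
    if h: "(f has_derivative h) (at p within M)" for h
  proof -
    have "(\<gamma> has_derivative (\<lambda>t. t *\<^sub>R v)) (at 0 within S)"
      using \<gamma>(3) has_derivative_at_withinI unfolding has_vector_derivative_def by blast
    moreover have "(f has_derivative h) (at (\<gamma> 0) within \<gamma> ` S)"
      using h S(3) \<gamma>(1) has_derivative_subset by (metis image_subsetI)
    ultimately have "(f \<circ> \<gamma> has_derivative h \<circ> (\<lambda>t. t *\<^sub>R v)) (at 0 within S)"
      by (rule diff_chain_within)
    then show ?thesis using at_within_open[OF S(2,1)] by simp
  qed
  from has_derivative_unique[OF this[OF g'] this[OF f']]
  have "(frechet_derivative f (at p within M) \<circ> (\<lambda>t. t *\<^sub>R v)) 1 = (f' \<circ> (\<lambda>t. t *\<^sub>R v)) 1" by (rule fun_cong)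
  then show ?thesis by simp
qed

text \<open>On the segment of length \<open>2 \<eta> \<bar>t\<bar>\<close> in direction \<open>n\<close> centred at \<open>p + t v\<close>, the first-order term
  \<open>s (n \<bullet> n)\<close> dominates the error at the two ends, so \<open>F\<close> changes sign there.\<close>

lemma zero_near_tangent_line:
  fixes F :: "'a::euclidean_space \<Rightarrow> real"
  assumes \<Omega>: "open \<Omega>" "p \<in> \<Omega>" and F: "F p = 0" "continuous_on \<Omega> F"
    and F': "(F has_derivative (\<lambda>w. w \<bullet> n)) (at p)" and n: "n \<noteq> 0" and v: "v \<bullet> n = 0"
    and \<eta>: "0 < \<eta>" "\<eta> \<le> 1"
  shows "\<exists>\<delta>>0. \<forall>t. \<bar>t\<bar> < \<delta> \<longrightarrow> (\<exists>s. \<bar>s\<bar> \<le> \<eta> * \<bar>t\<bar> \<and>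
    p + t *\<^sub>R v + s *\<^sub>R n \<in> \<Omega> \<and> F (p + t *\<^sub>R v + s *\<^sub>R n) = 0)"
proof -
  define M where "M = norm v + norm n"
  have M: "0 < M" using n norm_ge_zero[of v] zero_less_norm_iff[of n] unfolding M_def by linarith
  have nn: "0 < n \<bullet> n" using n by simp
  \<comment> \<open>This error tolerance makes the remainder at most half of the first-order term at the ends.\<close>
  define \<epsilon> where "\<epsilon> = \<eta> * (n \<bullet> n) / (2 * M)"
  have "0 < \<epsilon>" unfolding \<epsilon>_def using \<eta> nn M by simp
  then obtain d1 where d1: "0 < d1"
    "\<And>y. norm (y - p) < d1 \<Longrightarrow> norm (F y - F p - (y - p) \<bullet> n) \<le> \<epsilon> * norm (y - p)"
    using F' unfolding has_derivative_at_alt by blast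
  obtain d2 where d2: "0 < d2" "ball p d2 \<subseteq> \<Omega>" using \<Omega> openE by blast
  define \<delta> where "\<delta> = min d1 d2 / M"
  have "\<exists>s. \<bar>s\<bar> \<le> \<eta> * \<bar>t\<bar> \<and> p + t *\<^sub>R v + s *\<^sub>R n \<in> \<Omega> \<and> F (p + t *\<^sub>R v + s *\<^sub>R n) = 0"
    if t: "\<bar>t\<bar> < \<delta>" for t
  proof -
    define y where "y s = p + t *\<^sub>R v + s *\<^sub>R n" for s
    have tM: "\<bar>t\<bar> * M < min d1 d2" using t M unfolding \<delta>_def by (simp add: pos_less_divide_eq)
    have dist: "norm (y s - p) \<le> \<bar>t\<bar> * M" if "\<bar>s\<bar> \<le> \<eta> * \<bar>t\<bar>" for s
    proof -
      have "\<eta> * \<bar>t\<bar> \<le> 1 * \<bar>t\<bar>" using \<eta> by (intro mult_right_mono) auto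
      then have "\<bar>s\<bar> * norm n \<le> \<bar>t\<bar> * norm n" using that by (intro mult_right_mono) auto
      moreover have "norm (y s - p) \<le> norm (t *\<^sub>R v) + norm (s *\<^sub>R n)"
        using norm_triangle_ineq[of "t *\<^sub>R v" "s *\<^sub>R n"] by (simp add: y_def add.assoc)
      ultimately show ?thesis unfolding M_def by (simp add: distrib_left)
    qed
    have in\<Omega>: "y s \<in> \<Omega>" if "\<bar>s\<bar> \<le> \<eta> * \<bar>t\<bar>" for s
      using dist[OF that] tM d2(2) by (auto simp: subset_eq dist_norm norm_minus_commute)
    have est: "\<bar>F (y s) - s * (n \<bullet> n)\<bar> \<le> \<eta> * \<bar>t\<bar> * (n \<bullet> n) / 2" if "\<bar>s\<bar> \<le> \<eta> * \<bar>t\<bar>" for s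
    proof -
      have "norm (F (y s) - F p - (y s - p) \<bullet> n) \<le> \<epsilon> * norm (y s - p)"
        using dist[OF that] tM by (intro d1(2)) auto
      also have "\<dots> \<le> \<epsilon> * (\<bar>t\<bar> * M)" using dist[OF that] \<open>0 < \<epsilon>\<close> by simp
      also have "\<dots> = \<eta> * \<bar>t\<bar> * (n \<bullet> n) / 2" unfolding \<epsilon>_def using M by simp
      also have "(y s - p) \<bullet> n = s * (n \<bullet> n)"
        using v by (simp add: y_def add.assoc inner_add_left)
      finally show ?thesis using F(1) by simp
    qed
    let ?h = "\<eta> * \<bar>t\<bar>"
    have h: "0 \<le> ?h" using \<eta> by simp
    have hn: "0 \<le> ?h * (n \<bullet> n)" using h nn by simp
    have "\<bar>F (y (- ?h)) + ?h * (n \<bullet> n)\<bar> \<le> ?h * (n \<bullet> n) / 2" "\<bar>F (y ?h) - ?h * (n \<bullet> n)\<bar> \<le> ?h * (n \<bullet> n) / 2"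
      using est[of "-?h"] est[of ?h] h by simp_all
    with hn have sign: "F (y (-?h)) \<le> 0" "0 \<le> F (y ?h)" by linarith+
    have "continuous_on {-?h..?h} (\<lambda>s. F (y s))"
      by (rule continuous_on_compose2[OF F(2)])
         (use in\<Omega> in \<open>auto intro!: continuous_intros simp: y_def\<close>)
    with sign obtain s where "-?h \<le> s" "s \<le> ?h" "F (y s) = 0"
      using IVT'[of "\<lambda>s. F (y s)" "-?h" 0 ?h] h by auto
    then show ?thesis using in\<Omega>[of s] unfolding y_def by (intro exI[of _ s]) (simp add: abs_le_iff)
  qed
  moreover have "0 < \<delta>" unfolding \<delta>_def using d1(1) d2(1) M by simp
  ultimately show ?thesis by blast
qed

text \<open>The curve through \<open>p\<close> picks, for each \<open>t\<close>, a zero of \<open>F\<close> on the line through \<open>p + t v\<close> in direction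
  \<open>n\<close> whose offset \<open>\<sigma> t\<close> is almost as small as possible. By the previous lemma the offset is \<open>o(t)\<close>, and
  differentiability at \<open>0\<close> is all that the tangent space requires of a curve.\<close>

lemma hyperplane_subset_tangent_space:
  fixes F :: "'a::euclidean_space \<Rightarrow> real"
  assumes \<Omega>: "open \<Omega>" "p \<in> \<Omega>" and F: "F p = 0" "continuous_on \<Omega> F"
    and F': "(F has_derivative (\<lambda>w. w \<bullet> n)) (at p)" and n: "n \<noteq> 0" and v: "v \<bullet> n = 0"
  shows "v \<in> tangent_space {x\<in>\<Omega>. F x = 0} p"
proof -
  define R where "R t = {s. p + t *\<^sub>R v + s *\<^sub>R n \<in> \<Omega> \<and> F (p + t *\<^sub>R v + s *\<^sub>R n) = 0}" for t
  have near: "\<exists>\<delta>>0. \<forall>t. \<bar>t\<bar> < \<delta> \<longrightarrow> (\<exists>s. \<bar>s\<bar> \<le> \<eta> * \<bar>t\<bar> \<and> s \<in> R t)" if "0 < \<eta>" "\<eta> \<le> 1" for \<eta>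
    using zero_near_tangent_line[OF assms that] unfolding R_def mem_Collect_eq .
  \<comment> \<open>The slack \<open>t\<^sup>2\<close> replaces the existence of a minimal offset and is itself \<open>o(t)\<close>.\<close>
  have "\<exists>s. (t = 0 \<longrightarrow> s = 0) \<and> (R t \<noteq> {} \<longrightarrow> s \<in> R t \<and> (\<forall>s'\<in>R t. \<bar>s\<bar> \<le> \<bar>s'\<bar> + t\<^sup>2))" for t
  proof (cases "t = 0 \<or> R t = {}")
    case True
    then show ?thesis using \<Omega>(2) F(1) by (intro exI[of _ 0]) (auto simp: R_def)
  next
    case False
    then have "Inf (abs ` R t) < Inf (abs ` R t) + t\<^sup>2" "abs ` R t \<noteq> {}" by auto
    then obtain s where s: "s \<in> R t" "\<bar>s\<bar> < Inf (abs ` R t) + t\<^sup>2"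
      using cInf_lessD[of "abs ` R t"] by blast
    have "Inf (abs ` R t) \<le> \<bar>s'\<bar>" if "s' \<in> R t" for s'
    proof (rule cInf_lower)
      show "\<bar>s'\<bar> \<in> abs ` R t" using that by (rule imageI)
      show "bdd_below (abs ` R t)" by (rule bdd_belowI[of _ 0]) auto
    qed
    then have "\<forall>s'\<in>R t. \<bar>s\<bar> \<le> \<bar>s'\<bar> + t\<^sup>2"
      using s(2) by (meson add_right_mono less_imp_le order.strict_trans1 order_trans)
    then show ?thesis using s(1) False by (intro exI[of _ s]) simp
  qed
  then have "\<exists>\<sigma>. \<forall>t. (t = 0 \<longrightarrow> \<sigma> t = 0) \<and>
      (R t \<noteq> {} \<longrightarrow> \<sigma> t \<in> R t \<and> (\<forall>s'\<in>R t. \<bar>\<sigma> t\<bar> \<le> \<bar>s'\<bar> + t\<^sup>2))"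
    by (intro choice allI)
  then obtain \<sigma> where \<sigma>_all: "\<forall>t. (t = 0 \<longrightarrow> \<sigma> t = 0) \<and>
      (R t \<noteq> {} \<longrightarrow> \<sigma> t \<in> R t \<and> (\<forall>s'\<in>R t. \<bar>\<sigma> t\<bar> \<le> \<bar>s'\<bar> + t\<^sup>2))" ..
  have \<sigma>: "\<sigma> 0 = 0" "\<And>t. R t \<noteq> {} \<Longrightarrow> \<sigma> t \<in> R t"
    "\<And>t s. s \<in> R t \<Longrightarrow> \<bar>\<sigma> t\<bar> \<le> \<bar>s\<bar> + t\<^sup>2"
    using \<sigma>_all by blast+
  define \<gamma> where "\<gamma> t = p + t *\<^sub>R v + \<sigma> t *\<^sub>R n" for t
  have "(\<sigma> has_derivative (\<lambda>t. 0)) (at 0)"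
    unfolding has_derivative_at_alt
  proof (intro conjI allI impI)
    fix e :: real assume e: "0 < e"
    define \<eta> where "\<eta> = min (e/2) 1"
    have \<eta>: "0 < \<eta>" "\<eta> \<le> 1" "\<eta> \<le> e/2" using e by (auto simp: \<eta>_def)
    obtain \<delta> where \<delta>: "0 < \<delta>" "\<And>t. \<bar>t\<bar> < \<delta> \<Longrightarrow> \<exists>s. \<bar>s\<bar> \<le> \<eta> * \<bar>t\<bar> \<and> s \<in> R t"
      using near[OF \<eta>(1,2)] by blast
    have "\<bar>\<sigma> t\<bar> \<le> e * \<bar>t\<bar>" if "\<bar>t\<bar> < min \<delta> (e/2)" for t
    proof -
      obtain s where s: "s \<in> R t" "\<bar>s\<bar> \<le> \<eta> * \<bar>t\<bar>" using \<delta>(2) \<open>\<bar>t\<bar> < min \<delta> (e/2)\<close> by auto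
      have "\<bar>\<sigma> t\<bar> \<le> \<eta> * \<bar>t\<bar> + t\<^sup>2" using \<sigma>(3)[OF s(1)] s(2) by linarith
      also have "\<dots> = (\<eta> + \<bar>t\<bar>) * \<bar>t\<bar>" by (simp add: algebra_simps power2_eq_square)
      also have "\<dots> \<le> e * \<bar>t\<bar>" using \<eta>(3) that by (intro mult_right_mono) auto
      finally show ?thesis .
    qed
    then show "\<exists>d>0. \<forall>y. norm (y - 0) < d \<longrightarrow> norm (\<sigma> y - \<sigma> 0 - 0) \<le> e * norm (y - 0)"
      using e \<delta>(1) \<sigma>(1) by (intro exI[of _ "min \<delta> (e/2)"]) auto
  qed auto
  then have "(\<gamma> has_derivative (\<lambda>t. t *\<^sub>R v)) (at 0)"
    unfolding \<gamma>_def by (auto intro!: derivative_eq_intros)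
  moreover have "\<forall>\<^sub>F t in nhds 0. \<gamma> t \<in> {x\<in>\<Omega>. F x = 0}"
  proof -
    obtain \<delta> where \<delta>: "0 < \<delta>" "\<And>t. \<bar>t\<bar> < \<delta> \<Longrightarrow> \<exists>s. \<bar>s\<bar> \<le> 1 * \<bar>t\<bar> \<and> s \<in> R t"
      using near[OF zero_less_one order_refl] by (elim exE conjE) blast
    have "R t \<noteq> {}" if "\<bar>t\<bar> < \<delta>" for t using \<delta>(2)[OF that] by blast
    with \<delta>(1) show ?thesis
      using \<sigma>(2) by (auto simp: eventually_nhds_metric R_def \<gamma>_def)
  qed
  ultimately show ?thesis
    unfolding tangent_space_def has_vector_derivative_def using \<sigma>(1)
    by (intro CollectI exI[of _ \<gamma>]) (auto simp: \<gamma>_def)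
qed

lemma tangent_space_zero_set:
  fixes F :: "'a::euclidean_space \<Rightarrow> real"
  assumes \<Omega>: "open \<Omega>" "p \<in> \<Omega>" and F: "F p = 0" "continuous_on \<Omega> F"
    and F': "(F has_derivative (\<lambda>w. w \<bullet> n)) (at p)" and n: "n \<noteq> 0"
  shows "tangent_space {x\<in>\<Omega>. F x = 0} p = {v. v \<bullet> n = 0}"
proof (intro equalityI subsetI CollectI)
  fix v assume "v \<in> {v. v \<bullet> n = 0}"
  then show "v \<in> tangent_space {x\<in>\<Omega>. F x = 0} p" using hyperplane_subset_tangent_space[OF assms] by blast
next
  fix v assume v: "v \<in> tangent_space {x\<in>\<Omega>. F x = 0} p"
  let ?Z = "{x\<in>\<Omega>. F x = 0}"
  have "(F has_derivative (\<lambda>w. 0)) (at p within ?Z)"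
    by (rule has_derivative_transform[OF _ _ has_derivative_const[of 0]]) (use \<Omega> F in auto)
  from frechet_derivative_within_tangent[OF this v]
    frechet_derivative_within_tangent[OF has_derivative_at_withinI[OF F'] v]
  show "v \<bullet> n = 0" by simp
qed

text \<open>A function vanishing on the zero set of \<open>F\<close> is constant along tangent curves, so its gradient has
  only a component along the normal \<open>n\<close>.\<close>

lemma grad_parallel_on_zero_set:
  fixes F :: "'a::euclidean_space \<Rightarrow> real"
  assumes \<Omega>: "open \<Omega>" "p \<in> \<Omega>" and F: "F p = 0" "continuous_on \<Omega> F"
    and F': "(F has_derivative (\<lambda>w. w \<bullet> n)) (at p)" and n: "n \<noteq> 0"
    and g: "g differentiable (at p)" "\<And>x. x \<in> \<Omega> \<Longrightarrow> F x = 0 \<Longrightarrow> g x = 0"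
  shows "grad g p = (grad g p \<bullet> n / (n \<bullet> n)) *\<^sub>R n"
proof -
  let ?Z = "{x\<in>\<Omega>. F x = 0}"
  have tangent: "v \<bullet> grad g p = 0" if "v \<bullet> n = 0" for v
  proof -
    have v: "v \<in> tangent_space ?Z p" using tangent_space_zero_set[OF assms(1-6)] that by blast
    have "(g has_derivative (\<lambda>w. 0)) (at p within ?Z)"
      by (rule has_derivative_transform[OF _ _ has_derivative_const[of 0]]) (use \<Omega> F g(2) in auto)
    from frechet_derivative_within_tangent[OF this v]
      frechet_derivative_within_tangent[OF has_derivative_at_withinI[OF has_derivative_grad[OF g(1)]] v]
    show ?thesis by simp
  qed
  define d where "d = grad g p - (grad g p \<bullet> n / (n \<bullet> n)) *\<^sub>R n"
  have "d \<bullet> n = 0" using n by (simp add: d_def inner_diff_left)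
  moreover from this have "d \<bullet> grad g p = 0" by (rule tangent)
  ultimately have "d \<bullet> d = 0" by (subst (2) d_def) (simp add: inner_diff_right)
  then show ?thesis by (simp add: d_def)
qed

lemma onb_orthonormal_basis:
  fixes T :: "'a::euclidean_space set"
  assumes "subspace T"
  shows "pairwise orthogonal (onb T)" "\<And>b. b \<in> onb T \<Longrightarrow> norm b = 1" "span (onb T) = T"
proof -
  obtain B where "pairwise orthogonal B" "\<And>b. b \<in> B \<Longrightarrow> norm b = 1" "span B = T"
    using orthonormal_basis_subspace[OF assms] by metis
  then have "pairwise orthogonal B \<and> (\<forall>b\<in>B. norm b = 1) \<and> span B = T" by blast
  then have "pairwise orthogonal (onb T) \<and> (\<forall>b\<in>onb T. norm b = 1) \<and> span (onb T) = T"
    unfolding onb_def by (rule someI)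
  then show "pairwise orthogonal (onb T)" "\<And>b. b \<in> onb T \<Longrightarrow> norm b = 1" "span (onb T) = T"
    by blast+
qed

text \<open>Together with the normal \<open>n\<close>, the chosen orthonormal basis of the hyperplane \<open>n\<^sup>\<bottom>\<close> spans the whole
  space. The normal is not normalised: below it is a gradient, and dividing by \<open>n \<bullet> n\<close> avoids
  square roots.\<close>

locale hyperplane_frame =
  fixes n :: "'a::euclidean_space" and E :: "'a set"
  assumes n_nonzero: "n \<noteq> 0" and E_def: "E = onb {v. v \<bullet> n = 0}"
begin

lemma subspace_hyperplane: "subspace {v. v \<bullet> n = 0}"
  by (simp add: subspace_def inner_add_left)

lemma finite_E: "finite E"
  unfolding E_def using onb_orthonormal_basis(1)[OF subspace_hyperplane] pairwise_orthogonal_imp_finite by blast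

lemma E_orthogonal: "e \<in> E \<Longrightarrow> e \<bullet> n = 0"
  using onb_orthonormal_basis(3)[OF subspace_hyperplane] span_superset unfolding E_def by blast

lemma expand: "(\<Sum>e\<in>E. (x \<bullet> e) *\<^sub>R e) + ((x \<bullet> n) / (n \<bullet> n)) *\<^sub>R n = x"
proof -
  let ?y = "x - ((x \<bullet> n) / (n \<bullet> n)) *\<^sub>R n"
  have "?y \<in> span E"
    unfolding E_def onb_orthonormal_basis(3)[OF subspace_hyperplane]
    using n_nonzero by (simp add: inner_diff_left)
  then have "(\<Sum>e\<in>E. (?y \<bullet> e) *\<^sub>R e) = ?y"
    using onb_orthonormal_basis(1,2)[OF subspace_hyperplane] finite_E unfolding E_def
    by (intro orthonormal_basis_expand) auto
  moreover have "?y \<bullet> e = x \<bullet> e" if "e \<in> E" for e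
    using E_orthogonal[OF that] by (simp add: inner_diff_left inner_commute[of n e])
  then have "(\<Sum>e\<in>E. (?y \<bullet> e) *\<^sub>R e) = (\<Sum>e\<in>E. (x \<bullet> e) *\<^sub>R e)"
    by (intro sum.cong) auto
  ultimately show ?thesis by (simp only: diff_add_cancel)
qed

lemma orth_proj_hyperplane:
  "orth_proj {v. v \<bullet> n = 0} x = x - ((x \<bullet> n) / (n \<bullet> n)) *\<^sub>R n"
  unfolding orth_proj_def E_def[symmetric] using expand[of x] by (simp add: algebra_simps)

lemma parseval: "x \<bullet> y = (\<Sum>e\<in>E. (x \<bullet> e) * (y \<bullet> e)) + (x \<bullet> n) * (y \<bullet> n) / (n \<bullet> n)"
proof -
  have "x \<bullet> y = ((\<Sum>e\<in>E. (x \<bullet> e) *\<^sub>R e) + ((x \<bullet> n) / (n \<bullet> n)) *\<^sub>R n) \<bullet> y"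
    by (simp only: expand)
  then show ?thesis
    unfolding inner_add_left inner_sum_left inner_scaleR_left
    by (simp only: inner_commute[of _ y] times_divide_eq_left)
qed

lemma trace_split:
  assumes "linear f"
  shows "(\<Sum>b\<in>Basis. f b \<bullet> b) = (\<Sum>e\<in>E. f e \<bullet> e) + (f n \<bullet> n) / (n \<bullet> n)"
proof -
  have "f b \<bullet> b = (\<Sum>e\<in>E. (f e \<bullet> b) * (b \<bullet> e)) + (f n \<bullet> b) * (b \<bullet> n) / (n \<bullet> n)" for b
  proof -
    have "f b = f ((\<Sum>e\<in>E. (b \<bullet> e) *\<^sub>R e) + ((b \<bullet> n) / (n \<bullet> n)) *\<^sub>R n)"
      by (rule arg_cong[where f = f, OF expand[symmetric]])
    also have "\<dots> = (\<Sum>e\<in>E. (b \<bullet> e) *\<^sub>R f e) + ((b \<bullet> n) / (n \<bullet> n)) *\<^sub>R f n"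
      by (simp only: linear_add[OF assms] linear_sum[OF assms] linear_scale[OF assms])
    finally have "f b \<bullet> b = ((\<Sum>e\<in>E. (b \<bullet> e) *\<^sub>R f e) + ((b \<bullet> n) / (n \<bullet> n)) *\<^sub>R f n) \<bullet> b"
      by (simp only:)
    then show ?thesis
      unfolding inner_add_left inner_sum_left inner_scaleR_left by (simp add: mult.commute)
  qed
  then have "(\<Sum>b\<in>Basis. f b \<bullet> b) = (\<Sum>b\<in>Basis. \<Sum>e\<in>E. (f e \<bullet> b) * (b \<bullet> e))
      + (\<Sum>b\<in>Basis. (f n \<bullet> b) * (b \<bullet> n)) / (n \<bullet> n)"
    by (simp only: sum.distrib sum_divide_distrib)
  also have "(\<Sum>b\<in>Basis. (f n \<bullet> b) * (b \<bullet> n)) = f n \<bullet> n"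
    by (subst (2) euclidean_inner) (simp only: inner_commute[of n])
  also have "(\<Sum>b\<in>Basis. \<Sum>e\<in>E. (f e \<bullet> b) * (b \<bullet> e)) = (\<Sum>e\<in>E. f e \<bullet> e)"
  proof (subst sum.swap, rule sum.cong[OF refl])
    fix e
    show "(\<Sum>b\<in>Basis. (f e \<bullet> b) * (b \<bullet> e)) = f e \<bullet> e"
      by (subst (2) euclidean_inner) (simp only: inner_commute[of e])
  qed
  finally show ?thesis .
qed

end

lemma smooth_on_differentiable: "smooth_on S f \<Longrightarrow> x \<in> S \<Longrightarrow> f differentiable (at x)"
  using smooth_on_has_derivative differentiableI by blast

lemma smooth_on_mixed_partials_commute:
  assumes "open S" "smooth_on S f" "x \<in> S"
  shows "dirderiv v (dirderiv u f) x = dirderiv u (dirderiv v f) x"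
  using mixed_partials_commute[OF assms(1,3)] assms(2) unfolding smooth_on_def by blast

context
  fixes S :: "'a::euclidean_space set" and f g :: "'a \<Rightarrow> real" and x :: 'a
  assumes f: "smooth_on S f" and g: "smooth_on S g" and x: "x \<in> S"
begin

lemma dirderiv_add: "dirderiv v (\<lambda>y. f y + g y) x = dirderiv v f x + dirderiv v g x"
  by (rule frechet_derivative_eqI[OF has_derivative_add[OF
        smooth_on_has_derivative[OF f x] smooth_on_has_derivative[OF g x]]])

lemma dirderiv_diff: "dirderiv v (\<lambda>y. f y - g y) x = dirderiv v f x - dirderiv v g x"
  by (rule frechet_derivative_eqI[OF has_derivative_diff[OF
        smooth_on_has_derivative[OF f x] smooth_on_has_derivative[OF g x]]])

lemma dirderiv_mult:
  "dirderiv v (\<lambda>y. f y * g y) x = f x * dirderiv v g x + dirderiv v f x * g x"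
  by (rule frechet_derivative_eqI[OF has_derivative_mult[OF
        smooth_on_has_derivative[OF f x] smooth_on_has_derivative[OF g x]]])

lemma dirderiv_cmult: "dirderiv v (\<lambda>y. c * f y) x = c * dirderiv v f x"
  by (rule frechet_derivative_eqI[OF has_derivative_mult_right[OF smooth_on_has_derivative[OF f x]]])

end

lemma dirderiv_sum:
  assumes "\<And>i. i \<in> I \<Longrightarrow> smooth_on S (f i)" "x \<in> S"
  shows "dirderiv v (\<lambda>y. \<Sum>i\<in>I. f i y) x = (\<Sum>i\<in>I. dirderiv v (f i) x)"
  by (rule frechet_derivative_eqI[OF has_derivative_sum[OF smooth_on_has_derivative]])
     (use assms in auto)

section \<open>Functions vanishing to high order on a set\<close>

text \<open>All partial derivatives of order less than \<open>m\<close> vanish on \<open>Z\<close>; in particular order \<open>0\<close> is no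
  condition and order \<open>1\<close> is vanishing on \<open>Z\<close>.\<close>

primrec vanishes_to_order :: "nat \<Rightarrow> 'a::euclidean_space set \<Rightarrow> ('a \<Rightarrow> real) \<Rightarrow> bool" where
  "vanishes_to_order 0 Z f \<longleftrightarrow> True"
| "vanishes_to_order (Suc m) Z f \<longleftrightarrow>
     (\<forall>z\<in>Z. f z = 0) \<and> (\<forall>v. vanishes_to_order m Z (dirderiv v f))"

lemma vanishes_to_order_SucD:
  "vanishes_to_order (Suc m) Z f \<Longrightarrow> vanishes_to_order m Z f"
proof (induction m arbitrary: f)
  case (Suc m)
  have "vanishes_to_order m Z (dirderiv v f)" for v
    by (rule Suc.IH) (use Suc.prems in simp)
  then show ?case using Suc.prems by simp
qed simp

lemma vanishes_to_order_mono:
  "vanishes_to_order m Z f \<Longrightarrow> k \<le> m \<Longrightarrow> vanishes_to_order k Z f"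
proof (induction m)
  case (Suc m)
  show ?case
  proof (cases "k = Suc m")
    case False
    then have "k \<le> m" using Suc.prems(2) by simp
    with vanishes_to_order_SucD[OF Suc.prems(1)] show ?thesis by (rule Suc.IH)
  qed (use Suc.prems in simp)
qed simp

lemma vanishes_to_order_cong:
  assumes "open U" "Z \<subseteq> U" "\<And>x. x \<in> U \<Longrightarrow> f x = g x" "vanishes_to_order m Z f"
  shows "vanishes_to_order m Z g"
  using assms(3,4)
proof (induction m arbitrary: f g)
  case (Suc m)
  have "vanishes_to_order m Z (dirderiv v g)" for v
  proof (rule Suc.IH[of "dirderiv v f"])
    show "dirderiv v f x = dirderiv v g x" if "x \<in> U" for x
      using frechet_derivative_cong_open[OF assms(1) that] Suc.prems(1) by metis
    show "vanishes_to_order m Z (dirderiv v f)" using Suc.prems(2) by simp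
  qed
  moreover have "\<forall>z\<in>Z. g z = 0"
  proof
    fix z assume z: "z \<in> Z"
    then have "f z = 0" using Suc.prems(2) by simp
    moreover have "f z = g z" using z assms(2) by (intro Suc.prems(1)) blast
    ultimately show "g z = 0" by simp
  qed
  ultimately show ?case by simp
qed simp

context
  fixes U Z :: "'a::euclidean_space set"
  assumes U: "open U" and Z: "Z \<subseteq> U"
begin

lemma vanishes_to_order_add:
  assumes "smooth_on U f" "smooth_on U g" "vanishes_to_order m Z f" "vanishes_to_order m Z g"
  shows "vanishes_to_order m Z (\<lambda>x. f x + g x)"
  using assms
proof (induction m arbitrary: f g)
  case (Suc m)
  have "vanishes_to_order m Z (dirderiv v (\<lambda>x. f x + g x))" for v
  proof (rule vanishes_to_order_cong[OF U Z])
    show "dirderiv v f x + dirderiv v g x = dirderiv v (\<lambda>x. f x + g x) x" if "x \<in> U" for x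
      using dirderiv_add[OF Suc.prems(1,2) that] by simp
    show "vanishes_to_order m Z (\<lambda>x. dirderiv v f x + dirderiv v g x)"
      by (intro Suc.IH smooth_on_dirderiv) (use Suc.prems in simp_all)
  qed
  then show ?case using Suc.prems by simp
qed simp

lemma vanishes_to_order_mult:
  assumes "smooth_on U h" "smooth_on U f" "vanishes_to_order m Z f"
  shows "vanishes_to_order m Z (\<lambda>x. h x * f x)"
  using assms
proof (induction m arbitrary: h f)
  case (Suc m)
  have "vanishes_to_order m Z (dirderiv v (\<lambda>x. h x * f x))" for v
  proof (rule vanishes_to_order_cong[OF U Z])
    show "h x * dirderiv v f x + dirderiv v h x * f x = dirderiv v (\<lambda>x. h x * f x) x"
      if "x \<in> U" for x
      using dirderiv_mult[OF Suc.prems(1,2) that] by simp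
    have "vanishes_to_order m Z f" using Suc.prems(3) by (rule vanishes_to_order_SucD)
    then show "vanishes_to_order m Z (\<lambda>x. h x * dirderiv v f x + dirderiv v h x * f x)"
      by (intro vanishes_to_order_add Suc.IH smooth_on_mult U smooth_on_dirderiv)
         (use Suc.prems in simp_all)
  qed
  then show ?case using Suc.prems by simp
qed simp

lemma vanishes_to_order_derivation:
  assumes "\<And>b. smooth_on U (h b)" "smooth_on U f" "vanishes_to_order (Suc m) Z f"
  shows "vanishes_to_order m Z (\<lambda>x. \<Sum>b\<in>I. h b x * dirderiv b f x)"
proof -
  have f: "vanishes_to_order m Z f" using assms(3) by (rule vanishes_to_order_SucD)
  have zero: "vanishes_to_order m Z (\<lambda>x. 0)"
    using vanishes_to_order_mult[OF smooth_on_const[OF U, of 0] assms(2) f] by simp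
  show ?thesis
  proof (induction I rule: infinite_finite_induct)
    case (insert b I)
    have "vanishes_to_order m Z (dirderiv b f)" using assms(3) by simp
    then show ?case
      unfolding sum.insert[OF insert.hyps]
      by (intro vanishes_to_order_add vanishes_to_order_mult smooth_on_sum smooth_on_mult U
          smooth_on_dirderiv assms(1,2) insert.IH)
  qed (simp_all add: zero)
qed

end

lemma derivative_bound_by_partials:
  fixes f' :: "'a::euclidean_space \<Rightarrow> real"
  assumes "linear f'"
  shows "\<bar>f' v\<bar> \<le> (\<Sum>b\<in>Basis. \<bar>f' b\<bar>) * norm v"
proof -
  have "f' v = f' (\<Sum>b\<in>Basis. (v \<bullet> b) *\<^sub>R b)" by (simp only: euclidean_representation)
  also have "\<dots> = (\<Sum>b\<in>Basis. (v \<bullet> b) * f' b)"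
    by (simp only: linear_sum[OF assms] linear_scale[OF assms] real_scaleR_def)
  finally have "\<bar>f' v\<bar> \<le> (\<Sum>b\<in>Basis. \<bar>(v \<bullet> b) * f' b\<bar>)" by (simp only: sum_abs)
  also have "\<dots> \<le> (\<Sum>b\<in>Basis. \<bar>f' b\<bar> * norm v)"
  proof (rule sum_mono)
    fix b :: 'a assume "b \<in> Basis"
    then have "\<bar>v \<bullet> b\<bar> * \<bar>f' b\<bar> \<le> norm v * \<bar>f' b\<bar>"
      by (intro mult_right_mono Basis_le_norm) auto
    then show "\<bar>(v \<bullet> b) * f' b\<bar> \<le> \<bar>f' b\<bar> * norm v" by (simp only: abs_mult mult.commute)
  qed
  finally show ?thesis by (simp only: sum_distrib_right)
qed

text \<open>Iterated mean value theorem along the segment from \<open>z\<close> to \<open>x\<close>, which stays in the ball by convexity: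
  each order of vanishing contributes one factor \<open>norm (x - z)\<close>. The constant is uniform in \<open>z\<close>, so
  \<open>z\<close> can later be chosen close to \<open>x\<close>.\<close>

lemma vanishes_to_order_bound:
  fixes f :: "'a::euclidean_space \<Rightarrow> real"
  assumes "cball p R \<subseteq> U" "smooth_on U f" "vanishes_to_order m Z f"
  shows "\<exists>C\<ge>0. \<forall>x\<in>cball p R. \<forall>z\<in>Z \<inter> cball p R. \<bar>f x\<bar> \<le> C * norm (x - z) ^ m"
  using assms(2,3)
proof (induction m arbitrary: f)
  case 0
  have "bounded (f ` cball p R)"
    using smooth_on_imp_continuous_on[OF 0(1)] assms(1) continuous_on_subset
    by (intro compact_imp_bounded compact_continuous_image) auto
  then obtain C where C: "\<And>x. x \<in> cball p R \<Longrightarrow> \<bar>f x\<bar> \<le> C"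
    unfolding bounded_iff by fastforce
  then have "\<bar>f x\<bar> \<le> max C 0" if "x \<in> cball p R" for x
    using that by fastforce
  then show ?case by (intro exI[of _ "max C 0"]) auto
next
  case (Suc m)
  have "\<forall>b. \<exists>C\<ge>0. \<forall>x\<in>cball p R. \<forall>z\<in>Z \<inter> cball p R. \<bar>dirderiv b f x\<bar> \<le> C * norm (x - z) ^ m"
  proof
    fix b
    show "\<exists>C\<ge>0. \<forall>x\<in>cball p R. \<forall>z\<in>Z \<inter> cball p R. \<bar>dirderiv b f x\<bar> \<le> C * norm (x - z) ^ m"
      using Suc.prems by (intro Suc.IH smooth_on_dirderiv) simp_all
  qed
  then obtain C where C: "\<forall>b. C b \<ge> 0 \<and>
      (\<forall>x\<in>cball p R. \<forall>z\<in>Z \<inter> cball p R. \<bar>dirderiv b f x\<bar> \<le> C b * norm (x - z) ^ m)"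
    using choice[of "\<lambda>b C. C \<ge> 0 \<and> (\<forall>x\<in>cball p R. \<forall>z\<in>Z \<inter> cball p R. \<bar>dirderiv b f x\<bar> \<le> C * norm (x - z) ^ m)"]
    by blast
  define D where "D = (\<Sum>b\<in>Basis. C b)"
  have D: "0 \<le> D" unfolding D_def using C by (intro sum_nonneg) auto
  have "\<bar>f x\<bar> \<le> D * norm (x - z) ^ Suc m" if x: "x \<in> cball p R" and z: "z \<in> Z \<inter> cball p R" for x z
  proof -
    have seg: "closed_segment z x \<subseteq> cball p R"
      using x z by (intro closed_segment_subset) auto
    have on: "onorm (frechet_derivative f (at y)) \<le> D * norm (x - z) ^ m"
      if y: "y \<in> closed_segment z x" for y
    proof (rule onorm_le)
      fix v
      have yR: "y \<in> cball p R" using seg y by blast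
      have "norm (y - z) \<le> norm (x - z)"
        using y by (metis dist_commute dist_in_closed_segment dist_norm)
      then have pow: "norm (y - z) ^ m \<le> norm (x - z) ^ m" by (intro power_mono) auto
      have "linear (frechet_derivative f (at y))"
        using smooth_on_has_derivative[OF Suc.prems(1)] yR assms(1) has_derivative_linear by blast
      then have "\<bar>frechet_derivative f (at y) v\<bar> \<le> (\<Sum>b\<in>Basis. \<bar>dirderiv b f y\<bar>) * norm v"
        by (rule derivative_bound_by_partials)
      also have "(\<Sum>b\<in>Basis. \<bar>dirderiv b f y\<bar>) \<le> (\<Sum>b\<in>Basis. C b * norm (y - z) ^ m)"
        using C yR z by (intro sum_mono) blast
      also have "\<dots> = D * norm (y - z) ^ m" by (simp add: D_def sum_distrib_right)
      also have "\<dots> \<le> D * norm (x - z) ^ m" using pow D by (rule mult_left_mono)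
      finally show "norm (frechet_derivative f (at y) v) \<le> D * norm (x - z) ^ m * norm v"
        by (simp add: mult_right_mono)
    qed
    have "norm (f x - f z) \<le> D * norm (x - z) ^ m * norm (x - z)"
      by (rule differentiable_bound[OF convex_closed_segment[of z x] _ on])
         (use smooth_on_has_derivative[OF Suc.prems(1)] seg assms(1) in
           \<open>auto intro: has_derivative_at_withinI\<close>)
    moreover have "f z = 0" using Suc.prems(2) z by simp
    ultimately show ?thesis by (simp add: ac_simps)
  qed
  with D show ?case by blast
qed

section \<open>Division by a function with regular zero set\<close>

locale regular_function =
  fixes U :: "'a::euclidean_space set" and F :: "'a \<Rightarrow> real"
  assumes U: "open U" and F: "smooth_on U F" and regular: "\<And>x. x \<in> U \<Longrightarrow> grad F x \<noteq> 0"
begin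

definition Z :: "'a set" where "Z = {x\<in>U. F x = 0}"

text \<open>The components of the vector field \<open>X = \<nabla>F / \<bar>\<nabla>F\<bar>\<^sup>2\<close>, written with partial derivatives so that their
  smoothness is immediate. It is normalised by \<open>X F = 1\<close>; \<open>normal_deriv\<close> is the derivation \<open>X\<close>.\<close>

definition normal_coeff :: "'a \<Rightarrow> 'a \<Rightarrow> real" where
  "normal_coeff b x = inverse (\<Sum>c\<in>Basis. dirderiv c F x * dirderiv c F x) * dirderiv b F x"

definition normal_deriv :: "('a \<Rightarrow> real) \<Rightarrow> 'a \<Rightarrow> real" where
  "normal_deriv f x = (\<Sum>b\<in>Basis. normal_coeff b x * dirderiv b f x)"

lemma Z_subset: "Z \<subseteq> U" by (auto simp: Z_def)

lemma F_has_derivative: "x \<in> U \<Longrightarrow> (F has_derivative (\<lambda>v. v \<bullet> grad F x)) (at x)"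
  using has_derivative_grad smooth_on_differentiable[OF F] by blast

lemma sum_partials:
  assumes "x \<in> U" "f differentiable (at x)"
  shows "(\<Sum>c\<in>Basis. dirderiv c F x * dirderiv c f x) = grad F x \<bullet> grad f x"
  using assms dirderiv_eq_inner_grad[OF smooth_on_differentiable[OF F assms(1)]]
    dirderiv_eq_inner_grad[OF assms(2)]
  by (subst euclidean_inner) (simp add: inner_commute)

lemma normal_deriv_eq:
  assumes "x \<in> U" "f differentiable (at x)"
  shows "normal_deriv f x = (grad F x \<bullet> grad f x) / (grad F x \<bullet> grad F x)"
  unfolding normal_deriv_def normal_coeff_def
    sum_partials[OF assms(1) smooth_on_differentiable[OF F assms(1)]]
    sum_partials[OF assms, symmetric] mult.assoc sum_distrib_left[symmetric]
  by (simp add: divide_inverse mult.commute)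

lemma smooth_on_normal_coeff: "smooth_on U (normal_coeff b)"
proof -
  have "(\<Sum>c\<in>Basis. dirderiv c F x * dirderiv c F x) \<noteq> 0" if "x \<in> U" for x
    using regular[OF that] sum_partials[OF that smooth_on_differentiable[OF F that]] by simp
  then show ?thesis
    unfolding normal_coeff_def
    by (intro smooth_on_mult smooth_on_inverse smooth_on_sum smooth_on_dirderiv U F)
qed

lemma smooth_on_normal_deriv: "smooth_on U f \<Longrightarrow> smooth_on U (normal_deriv f)"
  unfolding normal_deriv_def
  by (intro smooth_on_mult smooth_on_sum smooth_on_dirderiv smooth_on_normal_coeff U)

lemma normal_deriv_F: "x \<in> U \<Longrightarrow> normal_deriv F x = 1"
  using normal_deriv_eq[OF _ smooth_on_differentiable[OF F]] regular by simp

lemma normal_deriv_diff: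
  assumes "smooth_on U f" "smooth_on U g" "x \<in> U"
  shows "normal_deriv (\<lambda>y. f y - g y) x = normal_deriv f x - normal_deriv g x"
  unfolding normal_deriv_def dirderiv_diff[OF assms] by (simp add: right_diff_distrib sum_subtractf)

lemma normal_deriv_mult:
  assumes "smooth_on U f" "smooth_on U g" "x \<in> U"
  shows "normal_deriv (\<lambda>y. f y * g y) x = f x * normal_deriv g x + normal_deriv f x * g x"
  unfolding normal_deriv_def dirderiv_mult[OF assms]
  unfolding distrib_left sum.distrib sum_distrib_left sum_distrib_right by (simp add: ac_simps)

lemma normal_deriv_F_mult:
  assumes "smooth_on U h" "x \<in> U"
  shows "normal_deriv (\<lambda>y. F y * h y) x = F x * normal_deriv h x + h x"
  using normal_deriv_mult[OF F assms] normal_deriv_F[OF assms(2)] by simp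

lemma normal_deriv_cmult:
  assumes "smooth_on U f" "x \<in> U"
  shows "normal_deriv (\<lambda>y. c * f y) x = c * normal_deriv f x"
  unfolding normal_deriv_def dirderiv_cmult[OF assms(1,1,2)]
  by (simp add: sum_distrib_left ac_simps)

text \<open>The commutator of a constant vector field with \<open>X\<close> is again a derivation, hence costs only one
  order of vanishing.\<close>

lemma dirderiv_normal_deriv:
  assumes "smooth_on U f" "x \<in> U"
  shows "dirderiv v (normal_deriv f) x = normal_deriv (dirderiv v f) x
    + (\<Sum>b\<in>Basis. dirderiv v (normal_coeff b) x * dirderiv b f x)"
proof -
  have "dirderiv v (normal_deriv f) x
      = (\<Sum>b\<in>Basis. dirderiv v (\<lambda>x. normal_coeff b x * dirderiv b f x) x)"
    unfolding normal_deriv_def[abs_def]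
    by (intro dirderiv_sum[of _ U]) (auto intro!: smooth_on_mult smooth_on_normal_coeff smooth_on_dirderiv U assms)
  also have "\<dots> = (\<Sum>b\<in>Basis. normal_coeff b x * dirderiv b (dirderiv v f) x
      + dirderiv v (normal_coeff b) x * dirderiv b f x)"
  proof (rule sum.cong[OF refl])
    fix b :: 'a
    have "dirderiv v (dirderiv b f) x = dirderiv b (dirderiv v f) x"
      by (rule smooth_on_mixed_partials_commute[OF U assms])
    then show "dirderiv v (\<lambda>x. normal_coeff b x * dirderiv b f x) x
        = normal_coeff b x * dirderiv b (dirderiv v f) x
          + dirderiv v (normal_coeff b) x * dirderiv b f x"
      using dirderiv_mult[OF smooth_on_normal_coeff smooth_on_dirderiv[OF assms(1)] assms(2),
          where v = v] by simp
  qed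
  finally show ?thesis unfolding normal_deriv_def sum.distrib .
qed

text \<open>For a function vanishing on \<open>Z\<close> it suffices to control the transversal derivative: tangential
  derivatives vanish on \<open>Z\<close> automatically, and the commutator formula passes this to all higher
  derivatives.\<close>

lemma vanishes_to_order_SucI:
  assumes "smooth_on U f" "\<And>z. z \<in> Z \<Longrightarrow> f z = 0" "vanishes_to_order m Z (normal_deriv f)"
  shows "vanishes_to_order (Suc m) Z f"
  using assms
proof (induction m arbitrary: f)
  case (Suc m)
  have f: "vanishes_to_order (Suc m) Z f"
    using Suc.prems vanishes_to_order_SucD by (intro Suc.IH) blast+
  have "vanishes_to_order (Suc m) Z (dirderiv v f)" for v
  proof (rule Suc.IH)
    show "smooth_on U (dirderiv v f)" using Suc.prems(1) by (rule smooth_on_dirderiv)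
    show "dirderiv v f z = 0" if z: "z \<in> Z" for z
    proof -
      have zU: "z \<in> U" "F z = 0" using z by (auto simp: Z_def)
      have d: "f differentiable (at z)" using smooth_on_differentiable[OF Suc.prems(1) zU(1)] .
      have "normal_deriv f z = 0" using Suc.prems(3) z by simp
      then have "grad f z \<bullet> grad F z = 0"
        using normal_deriv_eq[OF zU(1) d] regular[OF zU(1)] by (simp add: inner_commute)
      moreover have "grad f z = (grad f z \<bullet> grad F z / (grad F z \<bullet> grad F z)) *\<^sub>R grad F z"
        by (rule grad_parallel_on_zero_set[OF U zU smooth_on_imp_continuous_on[OF F]
              F_has_derivative[OF zU(1)] regular[OF zU(1)] d])
           (use Suc.prems(2) in \<open>auto simp: Z_def\<close>)
      ultimately have "grad f z = 0" by simp
      then show ?thesis using dirderiv_eq_inner_grad[OF d] by simp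
    qed
    show "vanishes_to_order m Z (normal_deriv (dirderiv v f))"
    proof (rule vanishes_to_order_cong[OF U Z_subset])
      show "dirderiv v (normal_deriv f) x
          + (\<Sum>b\<in>Basis. (-1) * dirderiv v (normal_coeff b) x * dirderiv b f x)
          = normal_deriv (dirderiv v f) x" if "x \<in> U" for x
        using dirderiv_normal_deriv[OF Suc.prems(1) that, of v] by (simp add: sum_negf)
      have sum: "vanishes_to_order m Z
          (\<lambda>x. \<Sum>b\<in>Basis. (-1) * dirderiv v (normal_coeff b) x * dirderiv b f x)"
        by (rule vanishes_to_order_derivation[OF U Z_subset _ Suc.prems(1) f])
           (intro smooth_on_mult U smooth_on_const smooth_on_dirderiv smooth_on_normal_coeff)
      have normal: "vanishes_to_order m Z (dirderiv v (normal_deriv f))"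
        using Suc.prems(3) by simp
      show "vanishes_to_order m Z (\<lambda>x. dirderiv v (normal_deriv f) x
          + (\<Sum>b\<in>Basis. (-1) * dirderiv v (normal_coeff b) x * dirderiv b f x))"
      proof (rule vanishes_to_order_add[OF U Z_subset _ _ normal sum])
        show "smooth_on U (dirderiv v (normal_deriv f))"
          by (intro smooth_on_dirderiv smooth_on_normal_deriv Suc.prems(1))
        show "smooth_on U (\<lambda>x. \<Sum>b\<in>Basis. (-1) * dirderiv v (normal_coeff b) x * dirderiv b f x)"
          by (intro smooth_on_sum smooth_on_mult U smooth_on_const smooth_on_dirderiv
              smooth_on_normal_coeff Suc.prems(1))
      qed
    qed
  qed
  then show ?case unfolding vanishes_to_order.simps(2)[of "Suc m"] using Suc.prems(2) by blast
qed simp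

text \<open>If \<open>f\<close> behaves like \<open>c F\<^sup>k\<close> with \<open>k = m + 1\<close>, then \<open>F X f = k f\<close> up to higher order, so subtracting
  \<open>F X f / k\<close> removes the leading term. Formally, \<open>X\<close> applied to the difference is
  \<open>1 - 1/k\<close> times the same difference for \<open>X f\<close> and \<open>k - 1\<close>, which gives the induction.\<close>

lemma taylor_step:
  assumes "smooth_on U f" "vanishes_to_order (Suc m) Z f"
  shows "vanishes_to_order (Suc (Suc m)) Z (\<lambda>x. f x - F x * (1 / real (Suc m) * normal_deriv f x))"
  using assms
proof (induction m arbitrary: f)
  case (0 f)
  let ?f' = "normal_deriv f"
  have f': "smooth_on U ?f'" using 0(1) by (rule smooth_on_normal_deriv)
  show ?case
  proof (rule vanishes_to_order_SucI)
    show "smooth_on U (\<lambda>x. f x - F x * (1 / real (Suc 0) * ?f' x))"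
      by (intro smooth_on_diff smooth_on_mult smooth_on_const U F 0 f')
    show "f z - F z * (1 / real (Suc 0) * ?f' z) = 0" if "z \<in> Z" for z
      using 0(2) that by (simp add: Z_def)
    show "vanishes_to_order (Suc 0) Z (normal_deriv (\<lambda>x. f x - F x * (1 / real (Suc 0) * ?f' x)))"
      using normal_deriv_diff[OF 0(1) smooth_on_mult[OF U F f']] normal_deriv_F_mult[OF f'] Z_subset
      by (auto simp: Z_def)
  qed
next
  case (Suc m f)
  let ?f' = "normal_deriv f" and ?c = "1 / real (Suc (Suc m))"
  have f': "smooth_on U ?f'" using Suc.prems(1) by (rule smooth_on_normal_deriv)
  have cf': "smooth_on U (\<lambda>x. ?c * ?f' x)" using f' by (rule smooth_on_cmult[OF U])
  have van: "vanishes_to_order (Suc m) Z ?f'"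
    unfolding normal_deriv_def[abs_def]
    by (rule vanishes_to_order_derivation[OF U Z_subset smooth_on_normal_coeff Suc.prems])
  show ?case
  proof (rule vanishes_to_order_SucI)
    show "smooth_on U (\<lambda>x. f x - F x * (?c * ?f' x))"
      by (intro smooth_on_diff smooth_on_mult smooth_on_const U F Suc.prems f')
    show "f z - F z * (?c * ?f' z) = 0" if "z \<in> Z" for z
      using Suc.prems(2) that by (simp add: Z_def)
    show "vanishes_to_order (Suc (Suc m)) Z (normal_deriv (\<lambda>x. f x - F x * (?c * ?f' x)))"
    proof (rule vanishes_to_order_cong[OF U Z_subset])
      show "(1 - ?c) * (?f' x - F x * (1 / real (Suc m) * normal_deriv ?f' x))
          = normal_deriv (\<lambda>x. f x - F x * (?c * ?f' x)) x" if "x \<in> U" for x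
      proof -
        have "normal_deriv (\<lambda>x. f x - F x * (?c * ?f' x)) x
            = ?f' x - (F x * (?c * normal_deriv ?f' x) + ?c * ?f' x)"
          using normal_deriv_diff[OF Suc.prems(1) smooth_on_mult[OF U F cf'] that]
            normal_deriv_F_mult[OF cf' that] normal_deriv_cmult[OF f' that, of ?c] by simp
        moreover have "(1 - c) * (A - B * (d * N)) = A - (B * (c * N) + c * A)"
          if "(1 - c) * d = c" for A B N c d :: real
        proof -
          have "(1 - c) * (A - B * (d * N)) = A - c * A - B * (((1 - c) * d) * N)" by algebra
          then show ?thesis using that by simp
        qed
        moreover have "(1 - ?c) * (1 / real (Suc m)) = ?c" by (simp add: field_simps)
        ultimately show ?thesis by presburger
      qed
      show "vanishes_to_order (Suc (Suc m)) Z
          (\<lambda>x. (1 - ?c) * (?f' x - F x * (1 / real (Suc m) * normal_deriv ?f' x)))"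
        by (intro vanishes_to_order_mult[OF U Z_subset] Suc.IH f' van smooth_on_const U
            smooth_on_diff smooth_on_mult F smooth_on_normal_deriv)
    qed
  qed
qed

lemma taylor_expansion:
  assumes "smooth_on U f" "\<And>z. z \<in> Z \<Longrightarrow> f z = 0"
  shows "\<exists>h. smooth_on U h \<and> vanishes_to_order (Suc m) Z (\<lambda>x. f x - F x * h x)"
proof (induction m)
  case 0
  show ?case using assms(2) by (intro exI[of _ "\<lambda>x. 0"]) (simp add: smooth_on_const[OF U])
next
  case (Suc m)
  then obtain h where h: "smooth_on U h" "vanishes_to_order (Suc m) Z (\<lambda>x. f x - F x * h x)" by blast
  let ?g = "\<lambda>x. f x - F x * h x"
  let ?h = "\<lambda>x. h x + 1 / real (Suc m) * normal_deriv ?g x"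
  have g: "smooth_on U ?g" by (intro smooth_on_diff smooth_on_mult U F assms(1) h(1))
  have "vanishes_to_order (Suc (Suc m)) Z (\<lambda>x. f x - F x * ?h x)"
    by (rule vanishes_to_order_cong[OF U Z_subset _ taylor_step[OF g h(2)]]) (simp add: algebra_simps)
  moreover have "smooth_on U ?h"
    by (intro smooth_on_add smooth_on_mult smooth_on_const U h(1) smooth_on_normal_deriv g)
  ultimately show ?case by blast
qed

lemma normal_deriv_eq_of_vanishes:
  assumes "smooth_on U f" "smooth_on U h" "vanishes_to_order 2 Z (\<lambda>x. f x - F x * h x)" "z \<in> Z"
  shows "h z = normal_deriv f z"
proof -
  have z: "z \<in> U" "F z = 0" using assms(4) by (auto simp: Z_def)
  have "dirderiv b (\<lambda>x. f x - F x * h x) z = 0" for b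
    using assms(3,4) by (simp add: numeral_2_eq_2)
  then have "normal_deriv (\<lambda>x. f x - F x * h x) z = 0" unfolding normal_deriv_def by simp
  then show ?thesis
    using normal_deriv_diff[OF assms(1) smooth_on_mult[OF U F assms(2)] z(1)]
      normal_deriv_F_mult[OF assms(2) z(1)] z(2) by simp
qed

text \<open>The distance to \<open>Z\<close> is controlled by \<open>\<bar>F\<bar>\<close>: moving from \<open>x\<close> along \<open>n = \<nabla>F(p)\<close>, in the direction in
  which \<open>\<bar>F\<bar>\<close> decreases, changes \<open>F\<close> at a rate of at least \<open>m = n \<bullet> n / 2\<close>, so a zero is met after time at
  most \<open>\<bar>F x\<bar> / m\<close>.\<close>

lemma zero_near_point:
  assumes p: "p \<in> Z" and R: "0 < R" "cball p R \<subseteq> U"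
  shows "\<exists>r>0. \<exists>c>0. r \<le> R \<and> (\<forall>x\<in>ball p r. \<exists>z\<in>Z \<inter> cball p R. norm (x - z) \<le> c * \<bar>F x\<bar>)"
proof -
  define n where "n = grad F p"
  have pU: "p \<in> U" "F p = 0" using p by (auto simp: Z_def)
  have nn: "0 < n \<bullet> n" and n0: "0 < norm n" using regular[OF pU(1)] by (auto simp: n_def)
  define m where "m = n \<bullet> n / 2"
  have m: "0 < m" using nn by (simp add: m_def)
  have "dirderiv n F p = n \<bullet> n"
    using dirderiv_eq_inner_grad[OF smooth_on_differentiable[OF F pU(1)]] by (simp add: n_def)
  then have mp: "m < dirderiv n F p" using nn by (simp add: m_def)
  have "isCont (dirderiv n F) p" "isCont F p"
    using smooth_on_imp_continuous_on[OF F] smooth_on_imp_continuous_on[OF smooth_on_dirderiv[OF F]]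
      U pU(1) by (auto simp: continuous_on_eq_continuous_at)
  obtain d1 where d1: "0 < d1" "\<And>y. dist y p < d1 \<Longrightarrow> m < dirderiv n F y"
  proof -
    from mp have "0 < dirderiv n F p - m" by simp
    then obtain d where d: "0 < d"
      "\<forall>y. dist y p < d \<longrightarrow> \<bar>dirderiv n F y - dirderiv n F p\<bar> < dirderiv n F p - m"
      using \<open>isCont (dirderiv n F) p\<close> unfolding continuous_at_eps_delta dist_real_def by blast
    have "m < dirderiv n F y" if "dist y p < d" for y
      using d(2)[rule_format, OF that] by linarith
    with d(1) show thesis by (rule that)
  qed
  \<comment> \<open>Half of the radius is for \<open>x\<close> itself, the other half for the way from \<open>x\<close> to the zero.\<close>
  define R' where "R' = min R d1 / 2"
  have R': "0 < R'" "2 * R' \<le> R" "2 * R' \<le> d1" using R(1) d1(1) by (auto simp: R'_def)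
  have "0 < R' * m / norm n" using R'(1) m n0 by simp
  then obtain d2 where d2: "0 < d2" "\<And>y. dist y p < d2 \<Longrightarrow> \<bar>F y\<bar> < R' * m / norm n"
    using \<open>isCont F p\<close> pU(2) unfolding continuous_at_eps_delta dist_real_def by fastforce
  define r where "r = min R' d2"
  define c where "c = norm n / m"
  have "\<exists>z\<in>Z \<inter> cball p R. norm (x - z) \<le> c * \<bar>F x\<bar>" if x: "x \<in> ball p r" for x
  proof (cases "F x = 0")
    case True
    have "x \<in> cball p R" using x R' by (auto simp: r_def)
    then show ?thesis using True R(2) by (intro bexI[of _ x]) (auto simp: Z_def)
  next
    case False
    define h where "h = \<bar>F x\<bar> / m"
    have h: "0 < h" using False m by (simp add: h_def)
    have hn: "h * norm n = c * \<bar>F x\<bar>" by (simp add: h_def c_def)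
    have "h * norm n < R'"
      using d2(2)[of x] x m n0 by (simp add: h_def r_def dist_commute field_simps)
    moreover have "dist p x < R'" using x by (simp add: r_def)
    ultimately have sumlt: "dist p x + h * norm n < 2 * R'" by simp
    \<comment> \<open>Multiplying by \<open>sgn (F x)\<close> treats both signs of \<open>F x\<close> at once.\<close>
    define v where "v = - (sgn (F x) *\<^sub>R n)"
    have nv: "norm v = norm n" using False by (simp add: v_def sgn_real_def)
    have near: "dist p (x + s *\<^sub>R v) < 2 * R'" if s: "0 \<le> s" "s \<le> h" for s
    proof -
      have "dist p (x + s *\<^sub>R v) \<le> dist p x + dist x (x + s *\<^sub>R v)" by (rule dist_triangle)
      also have "dist x (x + s *\<^sub>R v) = s * norm n" using s(1) nv by (simp add: dist_norm)
      also have "\<dots> \<le> h * norm n" using s(2) by (simp add: mult_right_mono)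
      finally show ?thesis using sumlt by linarith
    qed
    have inR: "x + s *\<^sub>R v \<in> cball p R" if "0 \<le> s" "s \<le> h" for s
      using near[OF that] R'(2) by simp
    have "\<exists>t. 0 < t \<and> t < h \<and> F (x + h *\<^sub>R v) - F x = h * frechet_derivative F (at (x + t *\<^sub>R v)) v"
      by (rule mean_value_along_line[OF h]) (use smooth_on_has_derivative[OF F] inR R(2) in blast)
    then obtain t where t: "0 < t" "t < h"
      and eq: "F (x + h *\<^sub>R v) - F x = h * dirderiv v F (x + t *\<^sub>R v)" by blast
    have tU: "x + t *\<^sub>R v \<in> U" using inR[of t] t R(2) by auto
    have "dirderiv v F (x + t *\<^sub>R v) = - sgn (F x) * dirderiv n F (x + t *\<^sub>R v)"
      using dirderiv_eq_inner_grad[OF smooth_on_differentiable[OF F tU]] by (simp add: v_def)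
    then have "sgn (F x) * (F (x + h *\<^sub>R v) - F x) = - h * dirderiv n F (x + t *\<^sub>R v)"
      unfolding eq using False by (simp add: sgn_real_def)
    moreover have "h * m \<le> h * dirderiv n F (x + t *\<^sub>R v)"
      using d1(2)[of "x + t *\<^sub>R v"] near[of t] t R'(3) h by (simp add: dist_commute)
    moreover have "h * m = \<bar>F x\<bar>" using m by (simp add: h_def)
    ultimately have "- sgn (F x) * F (x + h *\<^sub>R v) \<ge> 0"
      by (simp add: algebra_simps abs_sgn)
    moreover have "- sgn (F x) * F (x + 0 *\<^sub>R v) \<le> 0" by (simp add: sgn_real_def)
    moreover have "continuous_on {0..h} (\<lambda>s. - sgn (F x) * F (x + s *\<^sub>R v))"
      by (intro continuous_intros continuous_on_compose2[OF smooth_on_imp_continuous_on[OF F]])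
         (use inR R(2) in auto)
    ultimately obtain s where s: "0 \<le> s" "s \<le> h" "- sgn (F x) * F (x + s *\<^sub>R v) = 0"
      using IVT'[of "\<lambda>s. - sgn (F x) * F (x + s *\<^sub>R v)" 0 0 h] h by auto
    have "F (x + s *\<^sub>R v) = 0" using s(3) False by (simp add: sgn_real_def split: if_splits)
    then have "x + s *\<^sub>R v \<in> Z \<inter> cball p R" using inR[OF s(1,2)] R(2) by (auto simp: Z_def)
    moreover have "norm (x - (x + s *\<^sub>R v)) \<le> c * \<bar>F x\<bar>"
      using s(1,2) nv by (simp add: hn[symmetric] mult_right_mono)
    ultimately show ?thesis by blast
  qed
  moreover have "0 < r" "r \<le> R" using R' d2(1) by (auto simp: r_def)
  moreover have "0 < c" using m n0 by (simp add: c_def)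
  ultimately show ?thesis by blast
qed

lemma vanishes_to_order_F_bound:
  assumes "p \<in> Z" "smooth_on U f" "vanishes_to_order m Z f"
  shows "\<exists>r>0. \<exists>C. ball p r \<subseteq> U \<and> (\<forall>x\<in>ball p r. \<bar>f x\<bar> \<le> C * \<bar>F x\<bar> ^ m)"
proof -
  obtain R where R: "0 < R" "cball p R \<subseteq> U"
    using assms(1) U open_contains_cball[of U] Z_subset by blast
  obtain r c where r: "0 < r" "0 < c" "r \<le> R"
    and near: "\<forall>x\<in>ball p r. \<exists>z\<in>Z \<inter> cball p R. norm (x - z) \<le> c * \<bar>F x\<bar>"
    using zero_near_point[OF assms(1) R] by blast
  obtain C where C: "0 \<le> C"
    "\<forall>x\<in>cball p R. \<forall>z\<in>Z \<inter> cball p R. \<bar>f x\<bar> \<le> C * norm (x - z) ^ m"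
    using vanishes_to_order_bound[OF R(2) assms(2,3)] by blast
  have "\<bar>f x\<bar> \<le> (C * c ^ m) * \<bar>F x\<bar> ^ m" if x: "x \<in> ball p r" for x
  proof -
    obtain z where z: "z \<in> Z \<inter> cball p R" "norm (x - z) \<le> c * \<bar>F x\<bar>" using near x by blast
    have "x \<in> cball p R" using x r(3) by auto
    then have "\<bar>f x\<bar> \<le> C * norm (x - z) ^ m" using C(2) z(1) by blast
    also have "\<dots> \<le> C * (c * \<bar>F x\<bar>) ^ m"
      using z(2) C(1) by (intro mult_left_mono power_mono) auto
    finally show ?thesis by (simp only: power_mult_distrib mult.assoc)
  qed
  moreover have "ball p r \<subseteq> U" using r(3) R(2) by fastforce
  ultimately show ?thesis using r(1) by blast
qed

text \<open>Because \<open>inverse 0 = 0\<close> and \<open>g\<close> vanishes on \<open>Z\<close>, the expression \<open>g y * inverse (F y) ^ j\<close> is the quotient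
  \<open>g / F\<^sup>j\<close> extended by \<open>0\<close>. Near \<open>Z\<close> it is bounded by a multiple of \<open>F\<^sup>2\<close>, whose derivative on \<open>Z\<close> is \<open>0\<close>; the
  formula of the quotient rule gives \<open>0\<close> on \<open>Z\<close> as well, so it holds on and off \<open>Z\<close> alike.\<close>

lemma flat_quotient_has_derivative:
  assumes g: "smooth_on U g" "vanishes_to_order (Suc (Suc j)) Z g" and x: "x \<in> U"
  shows "((\<lambda>y. g y * inverse (F y) ^ j) has_derivative
    (\<lambda>v. dirderiv v g x * inverse (F x) ^ j
       + (- real j) * ((g x * dirderiv v F x) * inverse (F x) ^ Suc j))) (at x)"
proof (cases "F x = 0")
  case False
  have "((\<lambda>y. inverse (F y)) has_derivative
      (\<lambda>v. - (inverse (F x) * dirderiv v F x * inverse (F x)))) (at x)"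
    by (rule Deriv.has_derivative_inverse[OF False smooth_on_has_derivative[OF F x]])
  from has_derivative_power[OF this, of j]
  have "((\<lambda>y. inverse (F y) ^ j) has_derivative
      (\<lambda>v. of_nat j * - (inverse (F x) * dirderiv v F x * inverse (F x)) * inverse (F x) ^ (j - 1))) (at x)" .
  from has_derivative_mult[OF smooth_on_has_derivative[OF g(1) x] this]
  show ?thesis
    by (rule has_derivative_eq_rhs) (cases j; simp add: fun_eq_iff algebra_simps)
next
  case True
  then have xZ: "x \<in> Z" using x by (simp add: Z_def)
  obtain r C where r: "0 < r" "ball x r \<subseteq> U"
    and C: "\<forall>y\<in>ball x r. \<bar>g y\<bar> \<le> C * \<bar>F y\<bar> ^ Suc (Suc j)"
    using vanishes_to_order_F_bound[OF xZ g] by blast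
  let ?q = "\<lambda>y. g y * inverse (F y) ^ j"
  have q: "\<bar>?q y\<bar> \<le> \<bar>C\<bar> * (F y)\<^sup>2" if "y \<in> ball x r" for y
  proof (cases "F y = 0")
    case True
    then show ?thesis using C that by (fastforce simp: abs_mult)
  next
    case False
    have "\<bar>g y\<bar> \<le> C * \<bar>F y\<bar> ^ Suc (Suc j)" using C that by blast
    also have "\<dots> \<le> \<bar>C\<bar> * \<bar>F y\<bar> ^ Suc (Suc j)" by (intro mult_right_mono) auto
    finally have "\<bar>g y\<bar> * \<bar>inverse (F y)\<bar> ^ j \<le> \<bar>C\<bar> * \<bar>F y\<bar> ^ Suc (Suc j) * \<bar>inverse (F y)\<bar> ^ j"
      by (intro mult_right_mono) auto
    also have "\<dots> = \<bar>C\<bar> * (\<bar>F y\<bar>\<^sup>2 * (\<bar>F y\<bar> * \<bar>inverse (F y)\<bar>) ^ j)"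
      unfolding power_mult_distrib by (simp add: power2_eq_square)
    also have "\<bar>F y\<bar> * \<bar>inverse (F y)\<bar> = 1" using False by simp
    finally show ?thesis by (simp add: abs_mult power_abs)
  qed
  have gx: "g x = 0" "dirderiv v g x = 0" for v using g(2) xZ by auto
  have "((\<lambda>y. (F y)\<^sup>2) has_derivative (\<lambda>v. 0)) (at x)"
    using has_derivative_power[OF smooth_on_has_derivative[OF F x], of 2] True by simp
  then have sq: "\<exists>d>0. \<forall>y. norm (y - x) < d \<longrightarrow> norm ((F y)\<^sup>2) \<le> e * norm (y - x)" if "0 < e" for e
    using that True unfolding has_derivative_at_alt by simp
  have "(?q has_derivative (\<lambda>v. 0)) (at x)"
    unfolding has_derivative_at_alt
  proof (intro conjI allI impI)
    fix e :: real assume e: "0 < e"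
    define e' where "e' = e / (\<bar>C\<bar> + 1)"
    have e': "0 < e'" "\<bar>C\<bar> * e' \<le> e" using e by (auto simp: e'_def field_simps)
    obtain d where d: "0 < d" "\<And>y. norm (y - x) < d \<Longrightarrow> norm ((F y)\<^sup>2) \<le> e' * norm (y - x)"
      using sq[OF e'(1)] by blast
    have "norm (?q y - ?q x - 0) \<le> e * norm (y - x)" if y: "norm (y - x) < min d r" for y
    proof -
      have "norm (?q y - ?q x - 0) \<le> \<bar>C\<bar> * norm ((F y)\<^sup>2)"
        using q[of y] y gx by (simp add: dist_norm norm_minus_commute)
      also have "\<dots> \<le> \<bar>C\<bar> * (e' * norm (y - x))" using d(2)[of y] y by (intro mult_left_mono) auto
      also have "\<dots> \<le> e * norm (y - x)"
        unfolding mult.assoc[symmetric] using e'(2) by (rule mult_right_mono) simp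
      finally show ?thesis .
    qed
    then show "\<exists>d>0. \<forall>y. norm (y - x) < d \<longrightarrow> norm (?q y - ?q x - 0) \<le> e * norm (y - x)"
      using d(1) r(1) by (intro exI[of _ "min d r"]) auto
  qed simp
  then show ?thesis by (rule has_derivative_eq_rhs) (use gx in auto)
qed

lemma flat_quotient_isCont:
  assumes g: "smooth_on U g" "vanishes_to_order (Suc j) Z g" and x: "x \<in> U"
  shows "isCont (\<lambda>y. g y * inverse (F y) ^ j) x"
proof -
  have cont: "isCont F x" "isCont g x"
    using smooth_on_imp_continuous_on[OF F] smooth_on_imp_continuous_on[OF g(1)] U x
    by (auto simp: continuous_on_eq_continuous_at)
  show ?thesis
  proof (cases "F x = 0")
    case False
    then show ?thesis using cont by (intro continuous_intros)
  next
    case True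
    then have xZ: "x \<in> Z" using x by (simp add: Z_def)
    obtain r C where r: "0 < r" "ball x r \<subseteq> U"
      and C: "\<forall>y\<in>ball x r. \<bar>g y\<bar> \<le> C * \<bar>F y\<bar> ^ Suc j"
      using vanishes_to_order_F_bound[OF xZ g] by blast
    let ?q = "\<lambda>y. g y * inverse (F y) ^ j"
    have q: "norm (?q y) \<le> C * \<bar>F y\<bar>" if "y \<in> ball x r" for y
    proof (cases "F y = 0")
      case True
      then show ?thesis using C that by (fastforce simp: abs_mult)
    next
      case False
      have "\<bar>g y\<bar> * \<bar>inverse (F y)\<bar> ^ j \<le> C * \<bar>F y\<bar> ^ Suc j * \<bar>inverse (F y)\<bar> ^ j"
        using C that by (intro mult_right_mono) auto
      also have "\<dots> = C * (\<bar>F y\<bar> * (\<bar>F y\<bar> * \<bar>inverse (F y)\<bar>) ^ j)"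
        unfolding power_mult_distrib by simp
      also have "\<bar>F y\<bar> * \<bar>inverse (F y)\<bar> = 1" using False by simp
      finally show ?thesis by (simp add: abs_mult power_abs)
    qed
    have "((\<lambda>y. C * \<bar>F y\<bar>) \<longlongrightarrow> C * \<bar>F x\<bar>) (at x)"
      using cont(1) unfolding isCont_def by (intro tendsto_intros)
    then have "((\<lambda>y. C * \<bar>F y\<bar>) \<longlongrightarrow> 0) (at x)" using True by simp
    moreover have "\<forall>\<^sub>F y in at x. norm (?q y) \<le> C * \<bar>F y\<bar>"
      using q r(1) unfolding eventually_at by (intro exI[of _ r]) (simp add: dist_commute)
    ultimately have "(?q \<longlongrightarrow> 0) (at x)" by (rule Lim_null_comparison[rotated])
    moreover have "g x = 0" using g(2) xZ by simp
    ultimately show ?thesis unfolding isCont_def by simp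
  qed
qed

text \<open>Differentiating \<open>g / F\<^sup>j\<close> produces \<open>g' / F\<^sup>j\<close>, where the numerator loses one order of vanishing, and
  \<open>g F' / F\<^sup>j\<^sup>+\<^sup>1\<close>, where the power grows by one. Either way \<open>k\<close> drops by one, so \<open>Suc (j + k)\<close> orders
  suffice.\<close>

lemma flat_quotient_Ck:
  assumes "smooth_on U g" "vanishes_to_order (Suc (j + k)) Z g"
  shows "Ck_on k U (\<lambda>y. g y * inverse (F y) ^ j)"
  using assms
proof (induction k arbitrary: g j)
  case 0
  then show ?case
    using flat_quotient_isCont U by (auto simp: continuous_on_eq_continuous_at)
next
  case (Suc k)
  show ?case
  proof (rule Ck_on_SucI[OF U flat_quotient_has_derivative[OF Suc.prems(1)]])
    show "vanishes_to_order (Suc (Suc j)) Z g"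
      using Suc.prems(2) by (rule vanishes_to_order_mono) simp
    fix v
    have "vanishes_to_order (Suc (j + k)) Z (dirderiv v g)" using Suc.prems(2) by simp
    then have A: "Ck_on k U (\<lambda>y. dirderiv v g y * inverse (F y) ^ j)"
      by (intro Suc.IH smooth_on_dirderiv Suc.prems(1))
    have "vanishes_to_order (Suc (Suc j + k)) Z (\<lambda>y. dirderiv v F y * g y)"
      using Suc.prems(2) by (intro vanishes_to_order_mult[OF U Z_subset] smooth_on_dirderiv F Suc.prems(1)) simp
    then have B: "Ck_on k U (\<lambda>y. (g y * dirderiv v F y) * inverse (F y) ^ Suc j)"
      by (intro Suc.IH smooth_on_mult U smooth_on_dirderiv F Suc.prems(1)) (simp only: mult.commute)
    show "Ck_on k U (\<lambda>y. dirderiv v g y * inverse (F y) ^ j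
       + (- real j) * ((g y * dirderiv v F y) * inverse (F y) ^ Suc j))"
      by (rule Ck_on_add[OF U A Ck_on_mult[OF U Ck_on_const[OF U] B]])
  qed
qed

text \<open>For each \<open>k\<close> the quotient is the sum of a smooth Taylor part \<open>h\<close> and a flat remainder divided by
  \<open>F\<close>, which is \<open>C\<^sup>k\<close>. The part \<open>h\<close> depends on \<open>k\<close>, but the quotient does not, since \<open>h = X f\<close> on \<open>Z\<close>.\<close>

lemma local_division:
  assumes f: "smooth_on U f" "\<And>z. z \<in> Z \<Longrightarrow> f z = 0"
  shows "smooth_on U (\<lambda>x. if F x = 0 then normal_deriv f x else f x / F x)"
  unfolding smooth_on_def
proof
  fix k
  obtain h where h: "smooth_on U h" "vanishes_to_order (Suc (Suc k)) Z (\<lambda>x. f x - F x * h x)"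
    using taylor_expansion[OF f] by blast
  have g: "smooth_on U (\<lambda>x. f x - F x * h x)" by (intro smooth_on_diff smooth_on_mult U F f h)
  have "Ck_on k U (\<lambda>x. (f x - F x * h x) * inverse (F x) ^ 1)"
    by (rule flat_quotient_Ck[OF g]) (use h(2) in simp)
  moreover have "Ck_on k U h" using h(1) unfolding smooth_on_def by blast
  ultimately have C: "Ck_on k U (\<lambda>x. h x + (f x - F x * h x) * inverse (F x) ^ 1)"
    by (intro Ck_on_add[OF U])
  have van2: "vanishes_to_order 2 Z (\<lambda>x. f x - F x * h x)"
    using h(2) by (rule vanishes_to_order_mono) simp
  show "Ck_on k U (\<lambda>x. if F x = 0 then normal_deriv f x else f x / F x)"
  proof (rule Ck_on_cong[OF U _ C])
    fix x assume "x \<in> U"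
    then show "h x + (f x - F x * h x) * inverse (F x) ^ 1 = (if F x = 0 then normal_deriv f x else f x / F x)"
      using normal_deriv_eq_of_vanishes[OF f(1) h(1) van2, of x]
      by (auto simp: Z_def field_simps)
  qed
qed

end

lemma norm_grad_sq:
  assumes "f differentiable (at x)"
  shows "(\<Sum>b\<in>Basis. dirderiv b f x * dirderiv b f x) = (norm (grad f x))\<^sup>2"
  unfolding power2_norm_eq_inner dirderiv_eq_inner_grad[OF assms]
  by (subst euclidean_inner) (simp add: inner_commute)

text \<open>The set where the gradient does not vanish and the set where \<open>F\<close> does not vanish are open and
  cover \<open>\<Omega>\<close>. Lemma \<open>local_division\<close> applies on the former, and on the latter the quotient is explicit.\<close>

lemma smooth_division:
  fixes F f :: "'a::euclidean_space \<Rightarrow> real"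
  assumes \<Omega>: "open \<Omega>" and F: "smooth_on \<Omega> F" and f: "smooth_on \<Omega> f"
    and reg: "\<And>x. x \<in> \<Omega> \<Longrightarrow> F x = 0 \<Longrightarrow> grad F x \<noteq> 0"
    and zero: "\<And>x. x \<in> \<Omega> \<Longrightarrow> F x = 0 \<Longrightarrow> f x = 0"
  shows "\<exists>q. smooth_on \<Omega> q \<and> (\<forall>x\<in>\<Omega>. f x = F x * q x)"
proof -
  let ?\<rho> = "\<lambda>x. \<Sum>b\<in>Basis. dirderiv b F x * dirderiv b F x"
  define U where "U = {x\<in>\<Omega>. ?\<rho> x \<noteq> 0}"
  define V where "V = {x\<in>\<Omega>. F x \<noteq> 0}"
  have open_nonzero: "open {x\<in>\<Omega>. g x \<noteq> 0}" if "smooth_on \<Omega> g" for g :: "'a \<Rightarrow> real"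
  proof -
    have "open (\<Omega> \<inter> g -` (- {0}))"
      using smooth_on_imp_continuous_on[OF that] \<Omega> by (intro continuous_open_preimage) auto
    moreover have "\<Omega> \<inter> g -` (- {0}) = {x\<in>\<Omega>. g x \<noteq> 0}" by auto
    ultimately show ?thesis by simp
  qed
  have "smooth_on \<Omega> ?\<rho>" by (intro smooth_on_sum smooth_on_mult smooth_on_dirderiv \<Omega> F)
  then have U: "open U" unfolding U_def by (rule open_nonzero)
  have V: "open V" unfolding V_def using F by (rule open_nonzero)
  have sub: "U \<subseteq> \<Omega>" "V \<subseteq> \<Omega>" by (auto simp: U_def V_def)
  have \<rho>: "?\<rho> x = (norm (grad F x))\<^sup>2" if "x \<in> \<Omega>" for x
    using norm_grad_sq smooth_on_differentiable[OF F that] .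
  interpret reg: regular_function U F
  proof
    show "grad F x \<noteq> 0" if "x \<in> U" for x
    proof -
      have "?\<rho> x \<noteq> 0" "x \<in> \<Omega>" using that unfolding U_def by blast+
      then show ?thesis using \<rho>[of x] by fastforce
    qed
  qed (fact U, fact smooth_on_subset[OF F sub(1)])
  define q where "q x = (if F x = 0 then reg.normal_deriv f x else f x / F x)" for x
  have "smooth_on U q" unfolding q_def
    by (rule reg.local_division[OF smooth_on_subset[OF f sub(1)]]) (use zero sub in \<open>auto simp: reg.Z_def\<close>)
  moreover have "smooth_on V q"
  proof (rule smooth_on_cong[OF V])
    show "smooth_on V (\<lambda>x. f x * inverse (F x))"
      by (intro smooth_on_mult smooth_on_inverse V smooth_on_subset[OF F sub(2)]
          smooth_on_subset[OF f sub(2)]) (simp add: V_def)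
  qed (simp add: V_def q_def divide_inverse)
  ultimately have "smooth_on (U \<union> V) q" unfolding smooth_on_def using Ck_on_Un[OF U V] by blast
  moreover have "U \<union> V = \<Omega>"
  proof -
    have "x \<in> U \<union> V" if x: "x \<in> \<Omega>" for x
    proof (cases "F x = 0")
      case True
      then have "?\<rho> x \<noteq> 0" unfolding \<rho>[OF x] using reg[OF x] by simp
      then show ?thesis using x unfolding U_def by blast
    qed (use x in \<open>simp add: V_def\<close>)
    then show ?thesis using sub by blast
  qed
  moreover have "f x = F x * q x" if "x \<in> \<Omega>" for x using zero[OF that] by (simp add: q_def)
  ultimately show ?thesis by auto
qed

section \<open>The Jacobi operator along a minimal level set\<close>

lemma frechet_derivative_within_cong:
  assumes "p \<in> M" "\<And>q. q \<in> M \<Longrightarrow> f q = g q"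
  shows "frechet_derivative f (at p within M) = frechet_derivative g (at p within M)"
proof -
  have "(f has_derivative f') (at p within M) \<longleftrightarrow> (g has_derivative f') (at p within M)" for f'
    using has_derivative_transform[OF assms(1), of f g f'] has_derivative_transform[OF assms(1), of g f f']
      assms(2) by metis
  then show ?thesis unfolding frechet_derivative_def by simp
qed

lemma tangential_grad_cong:
  assumes "p \<in> M" "\<And>q. q \<in> M \<Longrightarrow> u q = u' q"
  shows "tangential_grad M u p = tangential_grad M u' p"
proof -
  have "frechet_derivative u (at p within M) = frechet_derivative u' (at p within M)"
    using assms by (rule frechet_derivative_within_cong)
  then show ?thesis unfolding tangential_grad_def by simp
qed

text \<open>This is what permits replacing \<open>w\<close> by a function given by a different formula off \<open>C\<close>.\<close>

lemma jacobi_operator_cong: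
  assumes "p \<in> M" "\<And>q. q \<in> M \<Longrightarrow> u q = u' q"
  shows "jacobi_operator M u p = jacobi_operator M u' p"
proof -
  have "tangential_grad M u q = tangential_grad M u' q" if "q \<in> M" for q
    using tangential_grad_cong[of q M u u'] that assms(2) by blast
  from frechet_derivative_within_cong[where f = "tangential_grad M u" and g = "tangential_grad M u'", OF assms(1) this]
  show ?thesis
    unfolding jacobi_operator_def laplace_beltrami_def tangential_div_def assms(2)[OF assms(1)] by simp
qed

locale smooth_function =
  fixes \<Omega> :: "'a::euclidean_space set" and G :: "'a \<Rightarrow> real"
  assumes \<Omega>: "open \<Omega>" and G: "smooth_on \<Omega> G"
begin

text \<open>The second and third derivatives as vector-valued maps: \<open>hess x v\<close> is the derivative of \<open>grad G\<close> in
  direction \<open>v\<close>, and \<open>third x u v\<close> the derivative of \<open>\<lambda>y. hess y v\<close> in direction \<open>u\<close>.\<close>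

definition hess :: "'a \<Rightarrow> 'a \<Rightarrow> 'a" where
  "hess x v = (\<Sum>b\<in>Basis. dirderiv v (dirderiv b G) x *\<^sub>R b)"

definition third :: "'a \<Rightarrow> 'a \<Rightarrow> 'a \<Rightarrow> 'a" where
  "third x u v = (\<Sum>b\<in>Basis. dirderiv u (dirderiv v (dirderiv b G)) x *\<^sub>R b)"

lemma smooth_components_has_derivative:
  assumes "\<And>b. smooth_on \<Omega> (f b)" "x \<in> \<Omega>"
  shows "((\<lambda>y. \<Sum>b\<in>Basis. f b y *\<^sub>R (b::'a)) has_derivative
    (\<lambda>u. \<Sum>b\<in>Basis. dirderiv u (f b) x *\<^sub>R b)) (at x)"
  by (intro has_derivative_sum has_derivative_scaleR_left smooth_on_has_derivative[OF assms])

lemma G_has_derivative: "x \<in> \<Omega> \<Longrightarrow> (G has_derivative (\<lambda>v. v \<bullet> grad G x)) (at x)"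
  using has_derivative_grad smooth_on_differentiable[OF G] by blast

lemma dirderiv_G: "x \<in> \<Omega> \<Longrightarrow> dirderiv v G x = v \<bullet> grad G x"
  using dirderiv_eq_inner_grad smooth_on_differentiable[OF G] by blast

lemma grad_has_derivative:
  assumes "x \<in> \<Omega>" shows "(grad G has_derivative hess x) (at x)"
proof -
  have "(\<Sum>b\<in>Basis. dirderiv b G y *\<^sub>R b) = grad G y" if "y \<in> \<Omega>" for y
    unfolding dirderiv_G[OF that] using euclidean_representation[of "grad G y"]
    by (simp add: inner_commute)
  from has_derivative_transform_within_open[OF smooth_components_has_derivative[OF
        smooth_on_dirderiv[OF G] assms] \<Omega> assms this]
  show ?thesis unfolding hess_def[abs_def] .
qed

lemma hess_has_derivative:
  assumes "x \<in> \<Omega>" shows "((\<lambda>y. hess y v) has_derivative (\<lambda>u. third x u v)) (at x)"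
  unfolding hess_def third_def
  by (intro smooth_components_has_derivative smooth_on_dirderiv G assms)

lemma dirderiv_dirderiv_G:
  assumes "x \<in> \<Omega>" shows "dirderiv v (dirderiv w G) x = hess x v \<bullet> w"
proof -
  have "((\<lambda>y. w \<bullet> grad G y) has_derivative (\<lambda>v. w \<bullet> hess x v)) (at x)"
    by (intro has_derivative_inner_right grad_has_derivative assms)
  from has_derivative_transform_within_open[OF this \<Omega> assms, of "dirderiv w G"]
  have "(dirderiv w G has_derivative (\<lambda>v. w \<bullet> hess x v)) (at x)" using dirderiv_G by simp
  from frechet_derivative_eqI[OF this] show ?thesis by (simp add: inner_commute)
qed

lemma hess_symmetric: "x \<in> \<Omega> \<Longrightarrow> hess x v \<bullet> w = hess x w \<bullet> v"
  using smooth_on_mixed_partials_commute[OF \<Omega> G] dirderiv_dirderiv_G by metis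

lemma linear_hess: "x \<in> \<Omega> \<Longrightarrow> linear (hess x)"
  using grad_has_derivative has_derivative_linear by blast

lemma third_symmetric: "x \<in> \<Omega> \<Longrightarrow> third x u v = third x v u"
  unfolding third_def using smooth_on_mixed_partials_commute[OF \<Omega> smooth_on_dirderiv[OF G]] by simp

lemma linear_third:
  assumes "x \<in> \<Omega>" shows "linear (third x u)"
proof -
  have "third x u = (\<lambda>v. third x v u)" by (rule ext) (rule third_symmetric[OF assms])
  then show ?thesis using has_derivative_linear[OF hess_has_derivative[OF assms, of u]] by simp
qed

text \<open>The product rule for the bilinear expression \<open>hess y (grad G y)\<close>, obtained by expanding its second
  argument in the standard basis.\<close>

lemma hess_grad_has_derivative:
  assumes x: "x \<in> \<Omega>"
  shows "((\<lambda>y. hess y (grad G y)) has_derivative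
    (\<lambda>u. third x u (grad G x) + hess x (hess x u))) (at x)"
proof -
  have expand: "(\<Sum>b\<in>Basis. (v \<bullet> b) *\<^sub>R f b) = f v" if "linear f" for f :: "'a \<Rightarrow> 'a" and v
  proof -
    have "f v = f (\<Sum>b\<in>Basis. (v \<bullet> b) *\<^sub>R b)" by (simp only: euclidean_representation)
    then show ?thesis by (simp only: linear_sum[OF that] linear_scale[OF that])
  qed
  have "((\<lambda>y. \<Sum>b\<in>Basis. (grad G y \<bullet> b) *\<^sub>R hess y b) has_derivative
      (\<lambda>u. \<Sum>b\<in>Basis. (grad G x \<bullet> b) *\<^sub>R third x u b + (hess x u \<bullet> b) *\<^sub>R hess x b)) (at x)"
    by (intro has_derivative_sum has_derivative_scaleR has_derivative_inner_left
        grad_has_derivative hess_has_derivative x)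
  then have "((\<lambda>y. \<Sum>b\<in>Basis. (grad G y \<bullet> b) *\<^sub>R hess y b) has_derivative
      (\<lambda>u. third x u (grad G x) + hess x (hess x u))) (at x)"
    by (simp only: sum.distrib expand[OF linear_third[OF x]] expand[OF linear_hess[OF x]])
  then show ?thesis
    by (rule has_derivative_transform_within_open[OF _ \<Omega> x]) (rule expand[OF linear_hess])
qed

lemma grad_sq_has_derivative:
  assumes x: "x \<in> \<Omega>"
  shows "((\<lambda>y. grad G y \<bullet> grad G y) has_derivative (\<lambda>u. 2 * (hess x u \<bullet> grad G x))) (at x)"
  using has_derivative_inner[OF grad_has_derivative[OF x] grad_has_derivative[OF x]]
  by (simp add: inner_commute)

text \<open>The gradient of \<open>\<bar>\<nabla>G\<bar>\<^sup>2\<close> is twice the Hessian applied to \<open>\<nabla>G\<close>, by symmetry of the Hessian.\<close>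

lemma L_op_eq:
  assumes x: "x \<in> \<Omega>"
  shows "L_op G x = (grad G x \<bullet> grad G x) * (\<Sum>b\<in>Basis. hess x b \<bullet> b) - hess x (grad G x) \<bullet> grad G x"
proof -
  have "laplacian G x = (\<Sum>b\<in>Basis. hess x b \<bullet> b)"
    unfolding laplacian_def
    by (intro sum.cong refl frechet_derivative_eqI has_derivative_inner_left grad_has_derivative x)
  moreover have "grad (\<lambda>y. grad G y \<bullet> grad G y) x = 2 *\<^sub>R hess x (grad G x)"
  proof (rule grad_eqI)
    have "2 * (hess x u \<bullet> grad G x) = u \<bullet> 2 *\<^sub>R hess x (grad G x)" for u
      using hess_symmetric[OF x, of u "grad G x"] by (simp add: inner_commute)
    with grad_sq_has_derivative[OF x]
    show "((\<lambda>y. grad G y \<bullet> grad G y) has_derivative (\<lambda>u. u \<bullet> 2 *\<^sub>R hess x (grad G x))) (at x)" by simp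
  qed
  ultimately show ?thesis unfolding L_op_def power2_norm_eq_inner by simp
qed

lemma smooth_on_L_op: "smooth_on \<Omega> (L_op G)"
proof (rule smooth_on_cong[OF \<Omega>])
  show "smooth_on \<Omega> (\<lambda>x. (\<Sum>b\<in>Basis. dirderiv b G x * dirderiv b G x)
      * (\<Sum>b\<in>Basis. dirderiv b (dirderiv b G) x)
      - (\<Sum>b\<in>Basis. \<Sum>c\<in>Basis. dirderiv b G x * dirderiv c G x * dirderiv b (dirderiv c G) x))"
    by (intro smooth_on_diff smooth_on_mult smooth_on_sum smooth_on_dirderiv \<Omega> G)
  fix x assume x: "x \<in> \<Omega>"
  let ?n = "grad G x"
  have "(\<Sum>b\<in>Basis. dirderiv b G x * dirderiv b G x) = ?n \<bullet> ?n"
    using norm_grad_sq[OF smooth_on_differentiable[OF G x]] by (simp only: power2_norm_eq_inner)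
  moreover have "(\<Sum>b\<in>Basis. dirderiv b (dirderiv b G) x) = (\<Sum>b\<in>Basis. hess x b \<bullet> b)"
    by (simp only: dirderiv_dirderiv_G[OF x])
  moreover have "(\<Sum>b\<in>Basis. \<Sum>c\<in>Basis. dirderiv b G x * dirderiv c G x * dirderiv b (dirderiv c G) x)
      = hess x ?n \<bullet> ?n"
  proof -
    have "(\<Sum>c\<in>Basis. dirderiv b G x * dirderiv c G x * dirderiv b (dirderiv c G) x)
        = (hess x ?n \<bullet> b) * (?n \<bullet> b)" for b
    proof -
      have "(\<Sum>c\<in>Basis. dirderiv b G x * dirderiv c G x * dirderiv b (dirderiv c G) x)
          = (\<Sum>c\<in>Basis. (b \<bullet> ?n) * ((hess x b \<bullet> c) * (?n \<bullet> c)))"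
        unfolding dirderiv_G[OF x] dirderiv_dirderiv_G[OF x]
        by (intro sum.cong refl) (simp only: inner_commute[of _ ?n] ac_simps)
      also have "\<dots> = (b \<bullet> ?n) * (hess x b \<bullet> ?n)"
        by (simp only: sum_distrib_left[symmetric] euclidean_inner[of "hess x b" ?n, symmetric])
      finally show ?thesis using hess_symmetric[OF x, of b ?n] by (simp only: inner_commute ac_simps)
    qed
    then show ?thesis by (simp only: euclidean_inner[of "hess x ?n" ?n, symmetric])
  qed
  ultimately show "(\<Sum>b\<in>Basis. dirderiv b G x * dirderiv b G x)
      * (\<Sum>b\<in>Basis. dirderiv b (dirderiv b G) x)
      - (\<Sum>b\<in>Basis. \<Sum>c\<in>Basis. dirderiv b G x * dirderiv c G x * dirderiv b (dirderiv c G) x) = L_op G x"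
    by (simp only: L_op_eq[OF x])
qed

lemma dirderiv_L_op:
  assumes x: "x \<in> \<Omega>"
  defines "n \<equiv> grad G x"
  shows "dirderiv u (L_op G) x = (n \<bullet> n) * (\<Sum>b\<in>Basis. third x u b \<bullet> b)
      + 2 * (hess x u \<bullet> n) * (\<Sum>b\<in>Basis. hess x b \<bullet> b)
      - (hess x n \<bullet> hess x u + (third x u n + hess x (hess x u)) \<bullet> n)"
proof -
  have "((\<lambda>y. (grad G y \<bullet> grad G y) * (\<Sum>b\<in>Basis. hess y b \<bullet> b) - hess y (grad G y) \<bullet> grad G y)
      has_derivative (\<lambda>u. (grad G x \<bullet> grad G x) * (\<Sum>b\<in>Basis. third x u b \<bullet> b)
        + 2 * (hess x u \<bullet> grad G x) * (\<Sum>b\<in>Basis. hess x b \<bullet> b)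
        - (hess x (grad G x) \<bullet> hess x u
           + (third x u (grad G x) + hess x (hess x u)) \<bullet> grad G x))) (at x)"
    by (intro has_derivative_diff has_derivative_mult grad_sq_has_derivative has_derivative_sum
        has_derivative_inner has_derivative_inner_left hess_has_derivative
        hess_grad_has_derivative grad_has_derivative x)
  from has_derivative_transform_within_open[OF this \<Omega> x, of "L_op G"]
  show ?thesis unfolding n_def using L_op_eq by (intro frechet_derivative_eqI) simp
qed

end

locale minimal_level_set = smooth_function +
  fixes C :: "'a set" and p :: 'a
  assumes C_def: "C = {x\<in>\<Omega>. G x = 0}"
    and regular: "\<And>x. x \<in> C \<Longrightarrow> grad G x \<noteq> 0"
    and p: "p \<in> C"
    and minimal: "mean_curvature_vector C p = 0"
begin

definition n :: 'a where "n = grad G p"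
definition E :: "'a set" where "E = onb {v. v \<bullet> n = 0}"
abbreviation H :: "'a \<Rightarrow> 'a" where "H \<equiv> hess p"
abbreviation T :: "'a \<Rightarrow> 'a \<Rightarrow> 'a" where "T \<equiv> third p"

lemma p\<Omega>: "p \<in> \<Omega>" using p C_def by simp

lemma n_nonzero: "n \<noteq> 0" using regular[OF p] by (simp add: n_def)

sublocale frame: hyperplane_frame n E
  by unfold_locales (simp_all add: n_nonzero E_def)

lemma tangent_space_C:
  assumes "q \<in> C" shows "tangent_space C q = {v. v \<bullet> grad G q = 0}"
proof -
  have "q \<in> \<Omega>" "G q = 0" using assms C_def by auto
  then show ?thesis
    unfolding C_def
    using tangent_space_zero_set[OF \<Omega> _ _ smooth_on_imp_continuous_on[OF G]
        G_has_derivative regular[OF assms]] by blast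
qed

lemma orth_proj_C:
  assumes "q \<in> C"
  shows "orth_proj (tangent_space C q) x = x - ((x \<bullet> grad G q) / (grad G q \<bullet> grad G q)) *\<^sub>R grad G q"
proof -
  interpret hyperplane_frame "grad G q" "onb {v. v \<bullet> grad G q = 0}"
    by unfold_locales (simp_all add: regular[OF assms])
  show ?thesis unfolding tangent_space_C[OF assms] by (rule orth_proj_hyperplane)
qed

lemma onb_tangent_space: "onb (tangent_space C p) = E"
  unfolding tangent_space_C[OF p] E_def n_def ..

lemma E_tangent: "e \<in> E \<Longrightarrow> e \<in> tangent_space C p"
  using frame.E_orthogonal unfolding tangent_space_C[OF p] n_def by simp

text \<open>At a point of \<open>C\<close> the projection of \<open>e'\<close> onto the tangent space is \<open>e' - \<alpha> N\<close> with \<open>N = \<nabla>G\<close> and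
  \<open>\<alpha> = (e' \<bullet> N) / (N \<bullet> N)\<close>. As \<open>\<alpha>\<close> vanishes at \<open>p\<close>, only the derivative of \<open>e' \<bullet> N\<close> contributes, and
  the result is normal to \<open>C\<close>.\<close>

lemma second_fundamental_form_C:
  assumes e: "e \<in> E" and e': "e' \<in> E"
  shows "second_fundamental_form C p e e' = - ((H e \<bullet> e') / (n \<bullet> n)) *\<^sub>R n"
proof -
  let ?N = "grad G"
  have nn: "grad G p \<bullet> grad G p \<noteq> 0" using regular[OF p] by simp
  have e'n: "e' \<bullet> grad G p = 0" using frame.E_orthogonal[OF e'] by (simp add: n_def)
  have "((\<lambda>q. (e' \<bullet> ?N q) * inverse (?N q \<bullet> ?N q)) has_derivative
      (\<lambda>u. (e' \<bullet> ?N p) * - (inverse (?N p \<bullet> ?N p) * (2 * (H u \<bullet> ?N p)) * inverse (?N p \<bullet> ?N p))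
          + (e' \<bullet> H u) * inverse (?N p \<bullet> ?N p))) (at p)"
    by (intro has_derivative_mult has_derivative_inner_right grad_has_derivative p\<Omega>
        Deriv.has_derivative_inverse nn grad_sq_has_derivative)
  then have "((\<lambda>q. (e' \<bullet> ?N q) * inverse (?N q \<bullet> ?N q)) has_derivative
      (\<lambda>u. (e' \<bullet> H u) * inverse (n \<bullet> n))) (at p)"
    unfolding e'n n_def by simp
  from has_derivative_diff[OF has_derivative_const has_derivative_scaleR[OF this grad_has_derivative[OF p\<Omega>]]]
  have "((\<lambda>q. e' - ((e' \<bullet> ?N q) * inverse (?N q \<bullet> ?N q)) *\<^sub>R ?N q) has_derivative
      (\<lambda>u. - ((e' \<bullet> H u) * inverse (n \<bullet> n)) *\<^sub>R n)) (at p)"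
    by (rule has_derivative_eq_rhs) (simp add: e'n n_def)
  then have within: "((\<lambda>q. e' - ((e' \<bullet> ?N q) * inverse (?N q \<bullet> ?N q)) *\<^sub>R ?N q) has_derivative
      (\<lambda>u. - ((e' \<bullet> H u) * inverse (n \<bullet> n)) *\<^sub>R n)) (at p within C)"
    by (rule has_derivative_at_withinI)
  have eq: "orth_proj (tangent_space C q) e' = e' - ((e' \<bullet> ?N q) * inverse (?N q \<bullet> ?N q)) *\<^sub>R ?N q"
    if "q \<in> C" for q using orth_proj_C[OF that] by (simp add: divide_inverse)
  from within have "((\<lambda>q. orth_proj (tangent_space C q) e') has_derivative
      (\<lambda>u. - ((e' \<bullet> H u) * inverse (n \<bullet> n)) *\<^sub>R n)) (at p within C)"
    by (rule has_derivative_transform[OF p, rotated]) (rule eq)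
  from frechet_derivative_within_tangent[OF this E_tangent[OF e]]
  have D: "frechet_derivative (\<lambda>q. orth_proj (tangent_space C q) e') (at p within C) e
      = - ((H e \<bullet> e') / (n \<bullet> n)) *\<^sub>R n"
    by (simp add: divide_inverse inner_commute[of e'])
  have proj: "orth_proj (tangent_space C p) (c *\<^sub>R n) = 0" for c
    using orth_proj_C[OF p] nn by (simp add: n_def)
  then show ?thesis unfolding second_fundamental_form_def Let_def D proj by simp
qed

lemma sum_hess_tangential: "(\<Sum>e\<in>E. H e \<bullet> e) = 0"
proof -
  have "0 = (\<Sum>e\<in>E. - ((H e \<bullet> e) / (n \<bullet> n)) *\<^sub>R n)"
    using minimal second_fundamental_form_C
    unfolding mean_curvature_vector_def onb_tangent_space by simp
  also have "\<dots> = - ((\<Sum>e\<in>E. H e \<bullet> e) / (n \<bullet> n)) *\<^sub>R n"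
    by (simp only: scaleR_sum_left[symmetric] sum_negf sum_divide_distrib)
  finally show ?thesis using n_nonzero by simp
qed

lemma norm_sq_second_fundamental_form_C:
  "norm_sq_second_fundamental_form C p = (\<Sum>e\<in>E. \<Sum>e'\<in>E. (H e \<bullet> e')\<^sup>2) / (n \<bullet> n)"
proof -
  have "(norm (second_fundamental_form C p e e'))\<^sup>2 = (H e \<bullet> e')\<^sup>2 / (n \<bullet> n)"
    if "e \<in> E" "e' \<in> E" for e e'
    unfolding second_fundamental_form_C[OF that] norm_scaleR power_mult_distrib power2_norm_eq_inner
    using n_nonzero by (simp add: power_divide power2_eq_square)
  then show ?thesis
    unfolding norm_sq_second_fundamental_form_def onb_tangent_space by (simp add: sum_divide_distrib)
qed

lemma tangential_grad_C:
  assumes q: "q \<in> C" and u: "(u has_derivative (\<lambda>v. v \<bullet> \<Gamma>)) (at q)"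
  shows "tangential_grad C u q = \<Gamma> - ((\<Gamma> \<bullet> grad G q) / (grad G q \<bullet> grad G q)) *\<^sub>R grad G q"
    (is "_ = ?\<xi>")
  unfolding tangential_grad_def
proof (rule the_equality)
  note T = tangent_space_C[OF q]
  have D: "frechet_derivative u (at q within C) v = v \<bullet> \<Gamma>" if "v \<in> tangent_space C q" for v
    using frechet_derivative_within_tangent[OF has_derivative_at_withinI[OF u] that] .
  show \<xi>: "?\<xi> \<in> tangent_space C q \<and> (\<forall>v\<in>tangent_space C q. ?\<xi> \<bullet> v = frechet_derivative u (at q within C) v)"
  proof (intro conjI ballI)
    show "?\<xi> \<in> tangent_space C q" unfolding T using regular[OF q] by (simp add: inner_diff_left)
    fix v assume v: "v \<in> tangent_space C q"
    then have "grad G q \<bullet> v = 0" unfolding T by (simp add: inner_commute)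
    then show "?\<xi> \<bullet> v = frechet_derivative u (at q within C) v"
      unfolding D[OF v] by (simp add: inner_diff_left inner_commute[of v])
  qed
  fix \<zeta> assume \<zeta>: "\<zeta> \<in> tangent_space C q \<and> (\<forall>v\<in>tangent_space C q. \<zeta> \<bullet> v = frechet_derivative u (at q within C) v)"
  have "\<zeta> - ?\<xi> \<in> tangent_space C q" using \<zeta> \<xi> unfolding T by (simp add: inner_diff_left)
  then have "(\<zeta> - ?\<xi>) \<bullet> (\<zeta> - ?\<xi>) = 0"
    using \<zeta> \<xi> by (subst inner_diff_left) simp
  then show "\<zeta> = ?\<xi>" by simp
qed

lemma inverse_norm_grad_has_derivative:
  assumes q: "q \<in> C"
  shows "((\<lambda>y. inverse (norm (grad G y))) has_derivative
    (\<lambda>v. - (inverse (norm (grad G q)) ^ 3 * (hess q v \<bullet> grad G q)))) (at q)"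
proof -
  have q\<Omega>: "q \<in> \<Omega>" using q C_def by simp
  have "((\<lambda>y. norm (grad G y)) has_derivative (\<lambda>v. hess q v \<bullet> sgn (grad G q))) (at q)"
    by (rule has_derivative_compose[OF grad_has_derivative[OF q\<Omega>] has_derivative_norm[OF regular[OF q]]])
  from Deriv.has_derivative_inverse[OF _ this] regular[OF q]
  have "((\<lambda>y. inverse (norm (grad G y))) has_derivative (\<lambda>v. - (inverse (norm (grad G q))
      * (hess q v \<bullet> sgn (grad G q)) * inverse (norm (grad G q))))) (at q)" by simp
  then show ?thesis
    by (rule has_derivative_eq_rhs) (simp add: fun_eq_iff sgn_div_norm power3_eq_cube)
qed

text \<open>Write the tangential gradient of \<open>1 / \<bar>N\<bar>\<close> as \<open>\<Gamma> - \<beta> N\<close> with \<open>N = \<nabla>G\<close> and \<open>\<Gamma> = - hess N / \<bar>N\<bar>\<^sup>3\<close> the full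
  gradient. In the tangential divergence of \<open>\<beta> N\<close> the derivative of \<open>\<beta>\<close> multiplies the normal and drops
  out, and what remains is \<open>\<beta>\<close> times the mean curvature trace, which is zero. So only \<open>\<Gamma>\<close>
  counts.\<close>

lemma laplace_beltrami_C:
  defines "W \<equiv> inverse (norm n)"
  shows "laplace_beltrami C (\<lambda>y. inverse (norm (grad G y))) p
    = (\<Sum>e\<in>E. 3 * W ^ 5 * (H e \<bullet> n) * (H n \<bullet> e) - W ^ 3 * ((T e n + H (H e)) \<bullet> e))"
proof -
  let ?N = "grad G" and ?w = "\<lambda>y. inverse (norm (grad G y))"
  define \<Gamma> where "\<Gamma> q = - (?w q ^ 3) *\<^sub>R hess q (?N q)" for q
  define \<beta> where "\<beta> q = (\<Gamma> q \<bullet> ?N q) * inverse (?N q \<bullet> ?N q)" for q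
  define \<Gamma>' where "\<Gamma>' u = - (W ^ 3) *\<^sub>R (T u n + H (H u)) + (3 * W ^ 5 * (H u \<bullet> n)) *\<^sub>R H n" for u
  have grad_w: "tangential_grad C ?w q = \<Gamma> q - \<beta> q *\<^sub>R ?N q" if q: "q \<in> C" for q
  proof -
    have "q \<in> \<Omega>" using q C_def by simp
    then have "- (?w q ^ 3 * (hess q v \<bullet> ?N q)) = v \<bullet> \<Gamma> q" for v
      using hess_symmetric[of q v "?N q"] by (simp add: \<Gamma>_def inner_commute)
    then have "(?w has_derivative (\<lambda>v. v \<bullet> \<Gamma> q)) (at q)"
      using inverse_norm_grad_has_derivative[OF q] by simp
    from tangential_grad_C[OF q this] show ?thesis unfolding \<beta>_def by (simp only: divide_inverse)
  qed
  have d\<Gamma>: "(\<Gamma> has_derivative \<Gamma>') (at p)"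
  proof -
    have "((\<lambda>q. ?w q ^ 3) has_derivative
        (\<lambda>u. of_nat 3 * - (W ^ 3 * (H u \<bullet> n)) * W ^ (3 - 1))) (at p)"
      using has_derivative_power[OF inverse_norm_grad_has_derivative[OF p], of 3]
      unfolding W_def n_def .
    from has_derivative_minus[OF this]
    have "((\<lambda>q. - (?w q ^ 3)) has_derivative (\<lambda>u. 3 * W ^ 5 * (H u \<bullet> n))) (at p)"
      by (rule has_derivative_eq_rhs) (simp add: fun_eq_iff eval_nat_numeral)
    from has_derivative_scaleR[OF this hess_grad_has_derivative[OF p\<Omega>]]
    show ?thesis unfolding \<Gamma>_def[abs_def] \<Gamma>'_def[abs_def] W_def n_def .
  qed
  have "?N p \<bullet> ?N p \<noteq> 0" using regular[OF p] by simp
  from has_derivative_mult[OF has_derivative_inner[OF d\<Gamma> grad_has_derivative[OF p\<Omega>]]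
      Deriv.has_derivative_inverse[OF this grad_sq_has_derivative[OF p\<Omega>]]]
  have "(\<lambda>q. (\<Gamma> q \<bullet> ?N q) * inverse (?N q \<bullet> ?N q)) differentiable (at p)"
    by (rule differentiableI)
  then have "\<beta> differentiable (at p)" unfolding \<beta>_def[abs_def] .
  then have d\<beta>: "(\<beta> has_derivative frechet_derivative \<beta> (at p)) (at p)"
    by (rule frechet_derivative_works[THEN iffD1])
  let ?\<beta>' = "frechet_derivative \<beta> (at p)"
  have "((\<lambda>q. \<Gamma> q - \<beta> q *\<^sub>R ?N q) has_derivative (\<lambda>u. \<Gamma>' u - (\<beta> p *\<^sub>R H u + ?\<beta>' u *\<^sub>R n))) (at p within C)"
    using has_derivative_diff[OF d\<Gamma> has_derivative_scaleR[OF d\<beta> grad_has_derivative[OF p\<Omega>]]]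
    unfolding n_def by (rule has_derivative_at_withinI)
  then have "(tangential_grad C ?w has_derivative (\<lambda>u. \<Gamma>' u - (\<beta> p *\<^sub>R H u + ?\<beta>' u *\<^sub>R n))) (at p within C)"
    by (rule has_derivative_transform[OF p, rotated]) (rule grad_w)
  note D = frechet_derivative_within_tangent[OF this E_tangent]
  have "laplace_beltrami C ?w p = (\<Sum>e\<in>E. (\<Gamma>' e - (\<beta> p *\<^sub>R H e + ?\<beta>' e *\<^sub>R n)) \<bullet> e)"
    unfolding laplace_beltrami_def tangential_div_def onb_tangent_space
    by (intro sum.cong refl) (simp only: D)
  also have "\<dots> = (\<Sum>e\<in>E. \<Gamma>' e \<bullet> e - \<beta> p * (H e \<bullet> e))"
  proof (rule sum.cong[OF refl])
    fix e assume "e \<in> E"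
    then have "n \<bullet> e = 0" using frame.E_orthogonal by (simp add: inner_commute)
    then show "(\<Gamma>' e - (\<beta> p *\<^sub>R H e + ?\<beta>' e *\<^sub>R n)) \<bullet> e = \<Gamma>' e \<bullet> e - \<beta> p * (H e \<bullet> e)"
      by (simp add: inner_diff_left inner_add_left)
  qed
  also have "\<dots> = (\<Sum>e\<in>E. \<Gamma>' e \<bullet> e)"
    unfolding sum_subtractf sum_distrib_left[symmetric] sum_hess_tangential by simp
  also have "\<dots> = (\<Sum>e\<in>E. 3 * W ^ 5 * (H e \<bullet> n) * (H n \<bullet> e) - W ^ 3 * ((T e n + H (H e)) \<bullet> e))"
    unfolding \<Gamma>'_def inner_add_left inner_scaleR_left by (simp add: inner_add_left)
  finally show ?thesis .
qed

lemma L_op_zero: "L_op G p = 0"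
  unfolding L_op_eq[OF p\<Omega>] frame.trace_split[OF linear_hess[OF p\<Omega>]] sum_hess_tangential
  using n_nonzero by (simp add: n_def)

text \<open>Both sides equal \<open>(n \<bullet> n) S2 - 2 S1\<close>. Parseval's identity splits \<open>He \<bullet> He\<close> and \<open>Hn \<bullet> Hn\<close> into tangential
  and normal parts, and symmetry of \<open>H\<close> identifies the normal part of \<open>He\<close> with \<open>Hn \<bullet> e\<close>. On the left the
  purely normal terms \<open>T n n \<bullet> n\<close> and \<open>(Hn \<bullet> n)\<^sup>2\<close> cancel; on the right \<open>\<bar>A\<bar>\<^sup>2\<close> cancels.\<close>

lemma normal_derivative_L_op:
  "dirderiv n (L_op G) p
    = - ((n \<bullet> n) * norm n ^ 3 * jacobi_operator C (\<lambda>y. inverse (norm (grad G y))) p)"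
proof -
  define W where "W = inverse (norm n)"
  define S1 where "S1 = (\<Sum>e\<in>E. (H n \<bullet> e)\<^sup>2)"
  define S2 where "S2 = (\<Sum>e\<in>E. T n e \<bullet> e)"
  define A where "A = norm_sq_second_fundamental_form C p"
  have nn: "n \<bullet> n \<noteq> 0" using n_nonzero by simp
  have sq: "norm n * norm n = n \<bullet> n" by (simp add: dot_square_norm power2_eq_square)
  have W: "W * norm n = 1" using n_nonzero by (simp add: W_def)
  have WW: "W * W * (n \<bullet> n) = 1" unfolding sq[symmetric] using W by algebra
  note sym = hess_symmetric[OF p\<Omega>]
  have HH: "(\<Sum>e\<in>E. H e \<bullet> H e) = A * (n \<bullet> n) + S1 / (n \<bullet> n)"
  proof -
    have "H e \<bullet> H e = (\<Sum>e'\<in>E. (H e \<bullet> e')\<^sup>2) + (H n \<bullet> e)\<^sup>2 / (n \<bullet> n)" for e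
      using frame.parseval[of "H e" "H e"] sym[of e n] by (simp add: power2_eq_square)
    moreover have "A * (n \<bullet> n) = (\<Sum>e\<in>E. \<Sum>e'\<in>E. (H e \<bullet> e')\<^sup>2)"
      unfolding A_def norm_sq_second_fundamental_form_C using nn by simp
    ultimately show ?thesis by (simp only: S1_def sum.distrib sum_divide_distrib)
  qed
  have QQ: "H n \<bullet> H n = S1 + (H n \<bullet> n)\<^sup>2 / (n \<bullet> n)"
    using frame.parseval[of "H n" "H n"] by (simp add: S1_def power2_eq_square)
  have "laplace_beltrami C (\<lambda>y. inverse (norm (grad G y))) p
      = (\<Sum>e\<in>E. 3 * W ^ 5 * (H n \<bullet> e)\<^sup>2 - W ^ 3 * (T n e \<bullet> e) - W ^ 3 * (H e \<bullet> H e))"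
    unfolding laplace_beltrami_C W_def[symmetric]
  proof (rule sum.cong[OF refl])
    fix e
    have "(T e n + H (H e)) \<bullet> e = T n e \<bullet> e + H e \<bullet> H e"
      using third_symmetric[OF p\<Omega>, of e n] sym[of "H e" e] by (simp add: inner_add_left)
    then show "3 * W ^ 5 * (H e \<bullet> n) * (H n \<bullet> e) - W ^ 3 * ((T e n + H (H e)) \<bullet> e)
        = 3 * W ^ 5 * (H n \<bullet> e)\<^sup>2 - W ^ 3 * (T n e \<bullet> e) - W ^ 3 * (H e \<bullet> H e)"
      using sym[of e n] by (simp add: power2_eq_square algebra_simps)
  qed
  also have "\<dots> = 3 * W ^ 5 * S1 - W ^ 3 * S2 - W ^ 3 * (A * (n \<bullet> n) + S1 / (n \<bullet> n))"
    unfolding HH[symmetric] by (simp only: S1_def S2_def sum_subtractf sum_distrib_left)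
  also have "S1 / (n \<bullet> n) = W * W * S1" using WW nn by (simp add: field_simps)
  finally have "jacobi_operator C (\<lambda>y. inverse (norm (grad G y))) p
      = 3 * W ^ 5 * S1 - W ^ 3 * S2 - W ^ 3 * (A * (n \<bullet> n) + W * W * S1) + A * W"
    unfolding jacobi_operator_def A_def W_def n_def by simp
  \<comment> \<open>Here the two terms with \<open>A\<close> cancel because \<open>W\<^sup>2 (n \<bullet> n) = 1\<close>.\<close>
  also have "\<dots> = 2 * W ^ 5 * S1 - W ^ 3 * S2"
    using WW by algebra
  finally have "- ((n \<bullet> n) * norm n ^ 3 * jacobi_operator C (\<lambda>y. inverse (norm (grad G y))) p)
      = (n \<bullet> n) * S2 - 2 * S1"
    using W WW by algebra
  moreover have "dirderiv n (L_op G) p = (n \<bullet> n) * S2 - 2 * S1"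
  proof -
    have "(\<Sum>b\<in>Basis. T n b \<bullet> b) = S2 + (T n n \<bullet> n) / (n \<bullet> n)"
      unfolding S2_def by (rule frame.trace_split[OF linear_third[OF p\<Omega>]])
    moreover have "(\<Sum>b\<in>Basis. H b \<bullet> b) = (H n \<bullet> n) / (n \<bullet> n)"
      using frame.trace_split[OF linear_hess[OF p\<Omega>]] sum_hess_tangential by simp
    moreover have "(T n n + H (H n)) \<bullet> n = T n n \<bullet> n + H n \<bullet> H n"
      using sym[of "H n" n] by (simp add: inner_add_left)
    ultimately show ?thesis
      using dirderiv_L_op[OF p\<Omega>, of n] nn QQ
      by (simp add: n_def[symmetric] field_simps power2_eq_square)
  qed
  ultimately show ?thesis by simp
qed

end

section \<open>The weighted defining function\<close>

locale minimal_zero_set =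
  fixes \<Omega> :: "'a::euclidean_space set" and F a :: "'a \<Rightarrow> real" and C :: "'a set" and w :: "'a \<Rightarrow> real"
  assumes \<Omega>: "open \<Omega>" and F: "smooth_on \<Omega> F" and a: "smooth_on \<Omega> a"
    and a_pos: "\<And>x. x \<in> \<Omega> \<Longrightarrow> a x > 0"
    and regular: "\<And>x. x \<in> \<Omega> \<Longrightarrow> F x = 0 \<Longrightarrow> grad F x \<noteq> 0"
    and minimal: "minimal_submanifold C"
    and C_def: "C = regular_zero_set \<Omega> F"
    and w_def: "w = (\<lambda>x. 1 / (a x * norm (grad F x)))"
begin

abbreviation G :: "'a \<Rightarrow> real" where "G \<equiv> (\<lambda>x. a x * F x)"

lemma C_eq_zero_set: "C = {x\<in>\<Omega>. G x = 0}"
proof -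
  have "a x \<noteq> 0" if "x \<in> \<Omega>" for x using a_pos[OF that] by simp
  then show ?thesis unfolding C_def regular_zero_set_def using regular by auto
qed

lemma C_D: "x \<in> C \<Longrightarrow> x \<in> \<Omega>" "x \<in> C \<Longrightarrow> F x = 0" "x \<in> C \<Longrightarrow> grad F x \<noteq> 0"
  unfolding C_def regular_zero_set_def by auto

lemma smooth_on_G: "smooth_on \<Omega> G"
  by (intro smooth_on_mult \<Omega> a F)

lemma grad_G:
  assumes "x \<in> C" shows "grad G x = a x *\<^sub>R grad F x"
proof (rule grad_eqI)
  note x = C_D(1)[OF assms]
  from has_derivative_mult[OF smooth_on_has_derivative[OF a x]
      has_derivative_grad[OF smooth_on_differentiable[OF F x]]]
  show "(G has_derivative (\<lambda>v. v \<bullet> a x *\<^sub>R grad F x)) (at x)"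
    by (rule has_derivative_eq_rhs) (simp add: C_D(2)[OF assms])
qed

lemma minimal_level_set_G:
  assumes "p \<in> C" shows "minimal_level_set \<Omega> G C p"
proof
  show "grad G x \<noteq> 0" if "x \<in> C" for x
    using grad_G[OF that] C_D[OF that] a_pos[of x] by simp
  show "mean_curvature_vector C p = 0"
    using minimal assms unfolding minimal_submanifold_def by blast
qed (fact \<Omega> smooth_on_G C_eq_zero_set assms)+

lemma L_op_G_zero: "p \<in> C \<Longrightarrow> L_op G p = 0"
  by (rule minimal_level_set.L_op_zero[OF minimal_level_set_G])

lemma smooth_on_L_op_G: "smooth_on \<Omega> (L_op G)"
  by (rule smooth_function.smooth_on_L_op) (unfold_locales, fact \<Omega>, fact smooth_on_G)

lemma smooth_quotient_extension_exists: "\<exists>K. smooth_quotient_extension \<Omega> (L_op G) F K"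
proof -
  have "L_op G x = 0" if "x \<in> \<Omega>" "F x = 0" for x
    using that by (intro L_op_G_zero) (simp add: C_eq_zero_set)
  then obtain q where "smooth_on \<Omega> q" "\<forall>x\<in>\<Omega>. L_op G x = F x * q x"
    using smooth_division[OF \<Omega> F smooth_on_L_op_G regular] by blast
  then have "smooth_quotient_extension \<Omega> (L_op G) F q"
    unfolding smooth_quotient_extension_def by simp
  then show ?thesis by (rule exI[of _ q])
qed

lemma w_pos: "p \<in> C \<Longrightarrow> w p > 0"
  unfolding w_def using C_D[of p] a_pos[of p] by simp

text \<open>Differentiate \<open>F K = L(G)\<close> along \<open>\<nabla>G = a \<nabla>F\<close> at a point of \<open>C\<close>: the left side gives
  \<open>a \<bar>\<nabla>F\<bar>\<^sup>2 K\<close> since \<open>F\<close> vanishes there, the right side is known, and the positive factor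
  \<open>a \<bar>\<nabla>F\<bar>\<^sup>2\<close> cancels.\<close>

lemma quotient_eq_jacobi:
  assumes K: "smooth_quotient_extension \<Omega> (L_op G) F K" and p: "p \<in> C"
  shows "K p = - ((a p) ^ 4 * (norm (grad F p)) ^ 3 * jacobi_operator C w p)"
proof -
  note p\<Omega> = C_D(1)[OF p]
  interpret level: minimal_level_set \<Omega> G C p using p by (rule minimal_level_set_G)
  define g where "g = norm (grad F p)"
  define J where "J = jacobi_operator C w p"
  have pos: "0 < a p" "0 < g" using a_pos[OF p\<Omega>] C_D(3)[OF p] by (auto simp: g_def)
  have n: "level.n = a p *\<^sub>R grad F p" unfolding level.n_def by (rule grad_G[OF p])
  have smooth_K: "smooth_on \<Omega> K" using K unfolding smooth_quotient_extension_def by blast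
  have FK: "F x * K x = L_op G x" if "x \<in> \<Omega>" for x
  proof (cases "F x = 0")
    case True
    then have "L_op G x = 0" using that by (intro L_op_G_zero) (simp add: C_eq_zero_set)
    then show ?thesis using True by simp
  qed (use K that in \<open>simp add: smooth_quotient_extension_def\<close>)
  have w_eq: "inverse (norm (grad G q)) = w q" if "q \<in> C" for q
    using grad_G[OF that] a_pos[OF C_D(1)[OF that]] by (simp add: w_def divide_inverse)
  have jacobi: "jacobi_operator C (\<lambda>y. inverse (norm (grad G y))) p = J"
    unfolding J_def by (rule jacobi_operator_cong[OF p]) (rule w_eq)
  have norm_n: "norm level.n = a p * g" unfolding n g_def using pos by simp
  have "level.n \<bullet> level.n = a p * a p * (g * g)"
    unfolding dot_square_norm norm_n by (simp add: power2_eq_square)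
  with level.normal_derivative_L_op
  have "dirderiv level.n (L_op G) p = - ((a p * a p * (g * g)) * (a p * g) ^ 3 * J)"
    unfolding jacobi norm_n by (simp only:)
  moreover have "dirderiv level.n (L_op G) p = dirderiv level.n F p * K p"
  proof -
    have "dirderiv level.n (L_op G) p = dirderiv level.n (\<lambda>x. F x * K x) p"
      using frechet_derivative_cong_open[OF \<Omega> p\<Omega>, of "L_op G" "\<lambda>x. F x * K x"] FK by simp
    then show ?thesis using dirderiv_mult[OF F smooth_K p\<Omega>] C_D(2)[OF p] by simp
  qed
  moreover have "dirderiv level.n F p = a p * (g * g)"
    unfolding dirderiv_eq_inner_grad[OF smooth_on_differentiable[OF F p\<Omega>]] n inner_scaleR_left
      dot_square_norm g_def power2_eq_square ..
  ultimately have "a p * (g * g) * K p = - ((a p * a p * (g * g)) * (a p * g) ^ 3 * J)"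
    by simp
  also have "\<dots> = a p * (g * g) * - (a p ^ 4 * g ^ 3 * J)"
    by (simp add: eval_nat_numeral)
  finally have "a p * (g * g) * K p = a p * (g * g) * - (a p ^ 4 * g ^ 3 * J)" .
  moreover have "a p * (g * g) \<noteq> 0" using pos by simp
  ultimately have "K p = - (a p ^ 4 * g ^ 3 * J)" using mult_left_cancel by blast
  then show ?thesis unfolding g_def J_def .
qed

end

theorem theorem4p7:
  fixes \<Omega> :: "(real ^ 'n) set" and F a :: "real ^ 'n \<Rightarrow> real"
  defines "C \<equiv> regular_zero_set \<Omega> F"
    and "w \<equiv> (\<lambda>x. 1 / (a x * norm (grad F x)))"
  assumes "open \<Omega>"
    and "smooth_on \<Omega> F" and "smooth_on \<Omega> a"
    and "\<forall>x\<in>\<Omega>. a x > 0"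
    and "\<forall>x\<in>\<Omega>. F x = 0 \<longrightarrow> grad F x \<noteq> 0"
    and "minimal_submanifold C"
  shows "(\<exists>K. smooth_quotient_extension \<Omega> (L_op (\<lambda>x. a x * F x)) F K) \<and>
    (\<forall>K. smooth_quotient_extension \<Omega> (L_op (\<lambda>x. a x * F x)) F K \<longrightarrow>
      (\<forall>p\<in>C. K p = - ((a p) ^ 4 * (norm (grad F p)) ^ 3 * jacobi_operator C w p)) \<and>
      ((\<exists>U. open U \<and> C \<subseteq> U \<and> (\<forall>x\<in>U \<inter> \<Omega>. K x \<ge> 0)) \<longrightarrow>
        (\<forall>p\<in>C. w p > 0 \<and> jacobi_operator C w p \<le> 0)) \<and>
      ((\<forall>p\<in>C. jacobi_operator C w p = 0) \<longleftrightarrow> (\<forall>p\<in>C. K p = 0)))"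
proof -
  interpret minimal_zero_set \<Omega> F a C w
    by unfold_locales (use assms in auto)
  have factor_pos: "0 < (a p) ^ 4 * (norm (grad F p)) ^ 3" if "p \<in> C" for p
    using a_pos[OF C_D(1)[OF that]] C_D(3)[OF that] by simp
  show ?thesis
  proof (intro conjI allI impI)
    show "\<exists>K. smooth_quotient_extension \<Omega> (L_op (\<lambda>x. a x * F x)) F K"
      by (rule smooth_quotient_extension_exists)
    fix K assume K: "smooth_quotient_extension \<Omega> (L_op (\<lambda>x. a x * F x)) F K"
    note formula = quotient_eq_jacobi[OF K]
    show "\<forall>p\<in>C. K p = - ((a p) ^ 4 * (norm (grad F p)) ^ 3 * jacobi_operator C w p)"
      using formula by (rule ballI)
    show "(\<forall>p\<in>C. jacobi_operator C w p = 0) \<longleftrightarrow> (\<forall>p\<in>C. K p = 0)"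
    proof -
      have "jacobi_operator C w p = 0 \<longleftrightarrow> K p = 0" if "p \<in> C" for p
        unfolding formula[OF that] using factor_pos[OF that] by auto
      then show ?thesis by blast
    qed
    assume "\<exists>U. open U \<and> C \<subseteq> U \<and> (\<forall>x\<in>U \<inter> \<Omega>. K x \<ge> 0)"
    then have K_nonneg: "K p \<ge> 0" if "p \<in> C" for p using that C_D(1)[OF that] by blast
    have "jacobi_operator C w p \<le> 0" if "p \<in> C" for p
    proof -
      have "(a p) ^ 4 * (norm (grad F p)) ^ 3 * jacobi_operator C w p \<le> 0"
        using K_nonneg[OF that] formula[OF that] by linarith
      then show ?thesis using factor_pos[OF that] by (meson mult_pos_pos not_le)
    qed
    then show "\<forall>p\<in>C. w p > 0 \<and> jacobi_operator C w p \<le> 0" using w_pos by blast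
  qed
qed

end
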